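(* Consider the following algorithm IRA for an instance $(k; m_1,\dots,m_k; t_1,\dots,t_M)$ of SMCC. (1) Solve the natural linear relaxation LPR optimally, obtaining an optimal solution $x^0$, and let $y_i=\sum_{j=1}^M x^0_{ij}t_j$ for $1\le i\le k$. (2) Set $b\gets y$ and $\mathcal{F}\gets\emptyset$. (3) While $M^*>0$: (a) if $M^*\ge 2k^*$: compute a basic solution $x$ of $\Lambda(b,\mathcal{F})$, choose a free machine $p$ and a free job $q$ with $x_{pq}=1$, and set $\mathcal{F}\gets\mathcal{F}\cup\{(p,q)\}$ ($b$ unchanged); (b) else, if some free machine $p$ has free capacity $m_p-c_p=1$: let $q$ be a free job with $t_q$ maximal among free jobs, set $\mathcal{F}\gets\mathcal{F}\cup\{(p,q)\}$ and $b_p\gets b_p+t_q$; (c) else (every free machine has free capacity at least $2$): assign the free jobs arbitrarily to free machines so that each free machine receives at most $2$ of them, add all these pairs (machine, job) to $\mathcal{F}$, and for each machine $p$ increase $b_p$ by the sum of the lengths $t_j$ of the jobs assigned to $p$ in this step. (4) Output the schedule assigning job $j$ to machine $i$ for every $(i,j)\in\mathcal{F}$. Then IRA is a $3$-approximation algorithm for SMCC: for every instance it outputs a schedule satisfying the capacity constraints whose makespan is at most $3\cdot\mathrm{OPT}$, where $\mathrm{OPT}$ is the minimum makespan of a schedule for the instance.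
   Context: SMCC (Scheduling Machines with Capacity Constraints): given a positive integer $k$, positive integers $m_1,\dots,m_k$, and $M\le\sum_{i=1}^k m_i$ non-negative integers $t_1,\dots,t_M$ (job lengths), a schedule assigns each job $j\in\{1,\dots,M\}$ to exactly one machine $i\in\{1,\dots,k\}$ so that machine $i$ receives at most $m_i$ jobs; its makespan is $\max_i\sum_{j\text{ assigned to }i}t_j$. The natural relaxation LPR is: minimize $c$ subject to $\sum_{j}x_{ij}t_j\le c$ and $\sum_j x_{ij}\le m_i$ for $1\le i\le k$, $\sum_i x_{ij}=1$ for $1\le j\le M$, $x_{ij}\ge0$. For a real vector $b=(b_1,\dots,b_k)$ (upper bounding vector) and a set $\mathcal{F}\subseteq\{1,\dots,k\}\times\{1,\dots,M\}$, the BLPR problem $\Lambda(b,\mathcal{F})$ is the feasibility problem in real variables $x_{ij}$ ($1\le i\le k$, $1\le j\le M$): $\sum_j x_{ij}t_j\le b_i$ and $\sum_j x_{ij}\le m_i$ for all $i$; $\sum_i x_{ij}=1$ for all $j$; $x_{ij}=1$ for $(i,j)\in\mathcal{F}$; $x_{ij}\ge0$. A basic solution is a feasible solution that is the unique solution of a set of linearly independent constraints of the problem holding with equality. Let $c_i=|\{j:(i,j)\in\mathcal{F}\}|$; $m_i-c_i$ is the free capacity of machine $i$. A job $j$ is free if $(i,j)\notin\mathcal{F}$ for all $i$; a machine $i$ is free if $c_i<m_i$. $M^*$ and $k^*$ denote the numbers of free jobs and free machines (with respect to the current $\mathcal{F}$). *)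

theory Defs imports Complex_Main begin

record smcc =
  num_machines :: nat
  capacity :: "nat \<Rightarrow> nat"
  num_jobs :: nat
  job_length :: "nat \<Rightarrow> nat"

definition machines :: "smcc \<Rightarrow> nat set" where
  "machines I = {1..num_machines I}"

definition jobs :: "smcc \<Rightarrow> nat set" where
  "jobs I = {1..num_jobs I}"

definition smcc_instance :: "smcc \<Rightarrow> bool" where
  "smcc_instance I \<longleftrightarrow>
     num_machines I > 0 \<and>
     (\<forall>i\<in>machines I. capacity I i > 0) \<and>
     num_jobs I \<le> (\<Sum>i\<in>machines I. capacity I i)"

text \<open>Assignments are sets of pairs (machine, job).\<close>

definition is_schedule :: "smcc \<Rightarrow> (nat \<times> nat) set \<Rightarrow> bool" where
  "is_schedule I A \<longleftrightarrow>
     A \<subseteq> machines I \<times> jobs I \<and>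
     (\<forall>j\<in>jobs I. \<exists>!i. (i, j) \<in> A) \<and>
     (\<forall>i\<in>machines I. card {j\<in>jobs I. (i, j) \<in> A} \<le> capacity I i)"

definition makespan :: "smcc \<Rightarrow> (nat \<times> nat) set \<Rightarrow> nat" where
  "makespan I A = Max ((\<lambda>i. \<Sum>j\<in>{j\<in>jobs I. (i, j) \<in> A}. job_length I j) ` machines I)"

definition OPT :: "smcc \<Rightarrow> nat" where
  "OPT I = Min (makespan I ` {A. is_schedule I A})"


definition lpr_feasible :: "smcc \<Rightarrow> real \<Rightarrow> (nat \<Rightarrow> nat \<Rightarrow> real) \<Rightarrow> bool" where
  "lpr_feasible I c x \<longleftrightarrow>
     (\<forall>i\<in>machines I. (\<Sum>j\<in>jobs I. x i j * real (job_length I j)) \<le> c) \<and>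
     (\<forall>i\<in>machines I. (\<Sum>j\<in>jobs I. x i j) \<le> real (capacity I i)) \<and>
     (\<forall>j\<in>jobs I. (\<Sum>i\<in>machines I. x i j) = 1) \<and>
     (\<forall>i\<in>machines I. \<forall>j\<in>jobs I. x i j \<ge> 0)"

definition lpr_optimal :: "smcc \<Rightarrow> (nat \<Rightarrow> nat \<Rightarrow> real) \<Rightarrow> bool" where
  "lpr_optimal I x \<longleftrightarrow>
     (\<exists>c. lpr_feasible I c x \<and> (\<forall>c' x'. lpr_feasible I c' x' \<longrightarrow> c \<le> c'))"


definition blpr_feasible ::
  "smcc \<Rightarrow> (nat \<Rightarrow> real) \<Rightarrow> (nat \<times> nat) set \<Rightarrow> (nat \<Rightarrow> nat \<Rightarrow> real) \<Rightarrow> bool" where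
  "blpr_feasible I b F x \<longleftrightarrow>
     (\<forall>i\<in>machines I. (\<Sum>j\<in>jobs I. x i j * real (job_length I j)) \<le> b i) \<and>
     (\<forall>i\<in>machines I. (\<Sum>j\<in>jobs I. x i j) \<le> real (capacity I i)) \<and>
     (\<forall>j\<in>jobs I. (\<Sum>i\<in>machines I. x i j) = 1) \<and>
     (\<forall>(i, j)\<in>F. x i j = 1) \<and>
     (\<forall>i\<in>machines I. \<forall>j\<in>jobs I. x i j \<ge> 0)"

text \<open>
  Names for the individual linear constraints of the BLPR problem. Each has a coefficient
  vector, indexed by the variables (i, j), and a right-hand side.
\<close>

datatype blpr_constraint =
    Load nat
  | Cap nat
  | Assign nat
  | Fixed nat nat
  | Nonneg nat nat

definition blpr_constraints :: "smcc \<Rightarrow> (nat \<times> nat) set \<Rightarrow> blpr_constraint set" where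
  "blpr_constraints I F =
     Load ` machines I \<union> Cap ` machines I \<union> Assign ` jobs I \<union>
     {Fixed i j | i j. (i, j) \<in> F} \<union>
     {Nonneg i j | i j. i \<in> machines I \<and> j \<in> jobs I}"

fun coeff :: "smcc \<Rightarrow> blpr_constraint \<Rightarrow> nat \<Rightarrow> nat \<Rightarrow> real" where
  "coeff I (Load p) i j = (if i = p then real (job_length I j) else 0)"
| "coeff I (Cap p) i j = (if i = p then 1 else 0)"
| "coeff I (Assign q) i j = (if j = q then 1 else 0)"
| "coeff I (Fixed p q) i j = (if i = p \<and> j = q then 1 else 0)"
| "coeff I (Nonneg p q) i j = (if i = p \<and> j = q then 1 else 0)"

fun rhs :: "smcc \<Rightarrow> (nat \<Rightarrow> real) \<Rightarrow> blpr_constraint \<Rightarrow> real" where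
  "rhs I b (Load p) = b p"
| "rhs I b (Cap p) = real (capacity I p)"
| "rhs I b (Assign q) = 1"
| "rhs I b (Fixed p q) = 1"
| "rhs I b (Nonneg p q) = 0"

definition holds_with_equality ::
  "smcc \<Rightarrow> (nat \<Rightarrow> real) \<Rightarrow> (nat \<Rightarrow> nat \<Rightarrow> real) \<Rightarrow> blpr_constraint \<Rightarrow> bool" where
  "holds_with_equality I b x C \<longleftrightarrow>
     (\<Sum>i\<in>machines I. \<Sum>j\<in>jobs I. coeff I C i j * x i j) = rhs I b C"

text \<open>
  Independence of the family of coefficient vectors: two constraints with the same coefficient
  vector are dependent.
\<close>

definition lin_independent :: "smcc \<Rightarrow> blpr_constraint set \<Rightarrow> bool" where
  "lin_independent I S \<longleftrightarrow>
     (\<forall>a. (\<forall>i\<in>machines I. \<forall>j\<in>jobs I. (\<Sum>C\<in>S. a C * coeff I C i j) = 0) \<longrightarrow>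
          (\<forall>C\<in>S. a C = 0))"

text \<open>Only the values of a solution on machines and jobs of the instance are relevant.\<close>

definition basic_solution ::
  "smcc \<Rightarrow> (nat \<Rightarrow> real) \<Rightarrow> (nat \<times> nat) set \<Rightarrow> (nat \<Rightarrow> nat \<Rightarrow> real) \<Rightarrow> bool" where
  "basic_solution I b F x \<longleftrightarrow>
     blpr_feasible I b F x \<and>
     (\<exists>S \<subseteq> blpr_constraints I F.
        lin_independent I S \<and>
        (\<forall>C\<in>S. holds_with_equality I b x C) \<and>
        (\<forall>z. (\<forall>C\<in>S. holds_with_equality I b z C) \<longrightarrow>
             (\<forall>i\<in>machines I. \<forall>j\<in>jobs I. z i j = x i j)))"


definition assigned_count :: "smcc \<Rightarrow> (nat \<times> nat) set \<Rightarrow> nat \<Rightarrow> nat" where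
  "assigned_count I F i = card {j\<in>jobs I. (i, j) \<in> F}"

definition free_jobs :: "smcc \<Rightarrow> (nat \<times> nat) set \<Rightarrow> nat set" where
  "free_jobs I F = {j\<in>jobs I. \<forall>i\<in>machines I. (i, j) \<notin> F}"

definition free_machines :: "smcc \<Rightarrow> (nat \<times> nat) set \<Rightarrow> nat set" where
  "free_machines I F = {i\<in>machines I. assigned_count I F i < capacity I i}"

definition free_capacity :: "smcc \<Rightarrow> (nat \<times> nat) set \<Rightarrow> nat \<Rightarrow> nat" where
  "free_capacity I F i = capacity I i - assigned_count I F i"

text \<open>
  IRA makes choices, so it is a transition relation. Computing a basic solution and choosing a
  pair from it are separate transitions: a basic solution without a suitable pair is thereby a
  reachable state from which the algorithm cannot continue.
\<close>

datatype ira_state =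
    Init
  | Loop "nat \<Rightarrow> real" "(nat \<times> nat) set"
  | Solved "nat \<Rightarrow> real" "(nat \<times> nat) set" "nat \<Rightarrow> nat \<Rightarrow> real"
  | Output "(nat \<times> nat) set"

inductive ira_step :: "smcc \<Rightarrow> ira_state \<Rightarrow> ira_state \<Rightarrow> bool" for I where
  init:
    "\<lbrakk>lpr_optimal I x0; y = (\<lambda>i. \<Sum>j\<in>jobs I. x0 i j * real (job_length I j))\<rbrakk>
     \<Longrightarrow> ira_step I Init (Loop y {})"
| solve:
    "\<lbrakk>card (free_jobs I F) > 0;
      card (free_jobs I F) \<ge> 2 * card (free_machines I F);
      basic_solution I b F x\<rbrakk>
     \<Longrightarrow> ira_step I (Loop b F) (Solved b F x)"
| fix_pair:
    "\<lbrakk>p \<in> free_machines I F; q \<in> free_jobs I F; x p q = 1\<rbrakk>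
     \<Longrightarrow> ira_step I (Solved b F x) (Loop b (F \<union> {(p, q)}))"
| longest:
    "\<lbrakk>card (free_jobs I F) > 0;
      card (free_jobs I F) < 2 * card (free_machines I F);
      p \<in> free_machines I F; free_capacity I F p = 1;
      q \<in> free_jobs I F; \<forall>j\<in>free_jobs I F. job_length I j \<le> job_length I q\<rbrakk>
     \<Longrightarrow> ira_step I (Loop b F)
           (Loop (b(p := b p + real (job_length I q))) (F \<union> {(p, q)}))"
| rest:
    "\<lbrakk>card (free_jobs I F) > 0;
      card (free_jobs I F) < 2 * card (free_machines I F);
      \<forall>p\<in>free_machines I F. free_capacity I F p \<noteq> 1;
      A \<subseteq> free_machines I F \<times> free_jobs I F;
      \<forall>j\<in>free_jobs I F. \<exists>!i. (i, j) \<in> A;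
      \<forall>i\<in>free_machines I F. card {j. (i, j) \<in> A} \<le> 2\<rbrakk>
     \<Longrightarrow> ira_step I (Loop b F)
           (Loop (\<lambda>p. b p + (\<Sum>j\<in>{j. (p, j) \<in> A}. real (job_length I j))) (F \<union> A))"
| finish:
    "card (free_jobs I F) = 0 \<Longrightarrow> ira_step I (Loop b F) (Output F)"

definition ira_reachable :: "smcc \<Rightarrow> ira_state \<Rightarrow> bool" where
  "ira_reachable I s \<longleftrightarrow> (ira_step I)\<^sup>*\<^sup>* Init s"

end

theory Submission imports "HOL-Analysis.Function_Topology" Defs begin

text \<open>
  The invariant is that the current BLPR problem stays feasible and that b is at most OPT on
  free machines as long as jobs are free. A basic solution has a pair with value 1 whenever
  M* is at least 2k*, because otherwise its support is larger than the rank of the remaining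
  rows. If M* < 2k* and a machine has a single free slot, exchanging its fractional jobs for a
  longest free job keeps the problem feasible; otherwise each machine can absorb two further
  jobs. Each machine is charged in only one of these two ways and at most once, so its bound
  grows from at most OPT by at most two job lengths, each at most OPT. When no job is free,
  feasibility says that the fixed pairs form a schedule with loads bounded by b.
\<close>

section \<open>Linear systems and capacitated assignments\<close>

text \<open>The constant 3 is 1 + 2: LPR relaxes SMCC, so the initial bounds are at most OPT, and a
  machine takes at most two jobs beyond its bound. The threshold 2k* fits both regimes. A free
  machine contributes two rows, load and capacity, and a split job at least two support entries, so
  M* \<ge> 2k* forces a kernel direction; M* < 2k* lets two slots per free machine hold all free
  jobs. A machine with a single free slot would overflow there, which is why (b) precedes (c). As
  IRA makes choices, the theorem also asserts that no run gets stuck; hence an LPR optimum and basic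
  solutions have to be shown to exist.\<close>

lemma underdetermined_system_nontrivial_solution:
  fixes A :: "'r \<Rightarrow> 'e \<Rightarrow> real"
  assumes "finite R" "finite E" "card R < card E"
  shows "\<exists>d. (\<exists>e\<in>E. d e \<noteq> 0) \<and> (\<forall>r\<in>R. (\<Sum>e\<in>E. A r e * d e) = 0)"
  using assms
proof (induction R arbitrary: E A rule: finite_induct)
  case empty
  then have "E \<noteq> {}" by auto
  then show ?case by (intro exI[of _ "\<lambda>_. 1"]) auto
next
  case (insert r R)
  show ?case
  proof (cases "\<forall>e\<in>E. A r e = 0")
    case True
    have "card R < card E" using insert by simp
    then obtain d where "\<exists>e\<in>E. d e \<noteq> 0" "\<forall>r\<in>R. (\<Sum>e\<in>E. A r e * d e) = 0"
      using insert.IH[OF insert.prems(1), of A] by blast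
    then show ?thesis using True by (intro exI[of _ d]) auto
  next
    case False
    \<comment> \<open>\<open>e0\<close> serves as pivot: subtracting multiples of row
      \<open>r\<close> clears column \<open>e0\<close> in the other rows. One row and one column
      disappear, so the strict inequality survives.\<close>
    then obtain e0 where e0: "e0 \<in> E" "A r e0 \<noteq> 0" by blast
    define E' where "E' = E - {e0}"
    have E': "finite E'" "card R < card E'"
      using insert e0 by (auto simp: E'_def)
    obtain d where d: "\<exists>e\<in>E'. d e \<noteq> 0"
      "\<forall>s\<in>R. (\<Sum>e\<in>E'. (A s e - A s e0 * A r e / A r e0) * d e) = 0"
      using insert.IH[OF E', of "\<lambda>s e. A s e - A s e0 * A r e / A r e0"] by blast
    define c where "c = - (\<Sum>e\<in>E'. A r e * d e) / A r e0"
    define d' where "d' = d(e0 := c)"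
    have split: "(\<Sum>e\<in>E. A s e * d' e) = A s e0 * c + (\<Sum>e\<in>E'. A s e * d e)" for s
    proof -
      have "(\<Sum>e\<in>E. A s e * d' e) = A s e0 * d' e0 + (\<Sum>e\<in>E'. A s e * d' e)"
        unfolding E'_def using e0 insert.prems by (simp add: sum.remove)
      moreover have "(\<Sum>e\<in>E'. A s e * d' e) = (\<Sum>e\<in>E'. A s e * d e)"
        by (rule sum.cong) (auto simp: E'_def d'_def)
      ultimately show ?thesis by (simp add: d'_def)
    qed
    have "(\<Sum>e\<in>E. A r e * d' e) = 0"
      using e0 by (simp add: split c_def)
    moreover have "(\<Sum>e\<in>E. A s e * d' e) = 0" if "s \<in> R" for s
    proof -
      have "0 = (\<Sum>e\<in>E'. A s e * d e - A s e0 / A r e0 * (A r e * d e))"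
        using d(2) that by (simp add: left_diff_distrib mult.assoc)
      also have "\<dots> = (\<Sum>e\<in>E'. A s e * d e) - A s e0 / A r e0 * (\<Sum>e\<in>E'. A r e * d e)"
        by (simp add: sum_subtractf sum_distrib_left)
      finally show ?thesis by (simp add: split c_def)
    qed
    moreover have "\<exists>e\<in>E. d' e \<noteq> 0"
      using d(1) by (auto simp: d'_def E'_def)
    ultimately show ?thesis by blast
  qed
qed

text \<open>Greedy filling: a new machine takes as many jobs as it can hold, and what remains fits
  into the other capacities. This supplies both a schedule (with \<open>capacity\<close>) and the
  assignment of the last step (with the constant 2).\<close>

lemma capacitated_assignment_exists:
  fixes cap :: "'i \<Rightarrow> nat"
  assumes "finite P" "finite J" "card J \<le> (\<Sum>i\<in>P. cap i)"
  shows "\<exists>A. A \<subseteq> P \<times> J \<and> (\<forall>j\<in>J. \<exists>!i. (i, j) \<in> A) \<and> (\<forall>i\<in>P. card {j. (i, j) \<in> A} \<le> cap i)"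
  using assms
proof (induction P arbitrary: J rule: finite_induct)
  case empty
  then show ?case by auto
next
  case (insert p P)
  obtain K where K: "K \<subseteq> J" "card K = min (cap p) (card J)"
    using obtain_subset_with_card_n[of "min (cap p) (card J)" J] by auto
  have "finite K" using K insert.prems(1) finite_subset by blast
  then have "card (J - K) \<le> (\<Sum>i\<in>P. cap i)"
    using K insert by (auto simp: card_Diff_subset)
  then obtain A where A: "A \<subseteq> P \<times> (J - K)" "\<forall>j\<in>J - K. \<exists>!i. (i, j) \<in> A"
    "\<forall>i\<in>P. card {j. (i, j) \<in> A} \<le> cap i"
    using insert.IH[of "J - K"] insert.prems(1) by auto
  define B where "B = A \<union> {p} \<times> K"
  have "\<exists>!i. (i, j) \<in> B" if "j \<in> J" for j
  proof (cases "j \<in> K")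
    case True
    then show ?thesis using A(1) by (auto simp: B_def)
  next
    case False
    then show ?thesis using A(2) that by (auto simp: B_def)
  qed
  moreover have "{j. (p, j) \<in> B} = K" using A(1) insert.hyps by (auto simp: B_def)
  moreover have "{j. (i, j) \<in> B} = {j. (i, j) \<in> A}" if "i \<in> P" for i
    using that insert.hyps by (auto simp: B_def)
  moreover have "B \<subseteq> insert p P \<times> J" using A(1) K(1) by (auto simp: B_def)
  ultimately show ?case using A(3) K(2) by (intro exI[of _ B]) auto
qed

lemma finite_machines [simp]: "finite (machines I)" and finite_jobs [simp]: "finite (jobs I)"
  by (simp_all add: machines_def jobs_def)

section \<open>Existence of an optimal solution of the relaxation\<close>

text \<open>Tychonoff's theorem, carried over from \<open>product_topology\<close> to the type-class
  topology on functions.\<close>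

lemma compact_PiE_UNIV:
  fixes S :: "'a \<Rightarrow> 'b::topological_space set"
  assumes "\<And>i. compact (S i)"
  shows "compact (PiE UNIV S)"
proof -
  have "compactin (product_topology (\<lambda>_. euclidean) UNIV) (PiE UNIV S)"
    using assms by (subst compactin_PiE) simp
  then show ?thesis
    by (metis compactin_euclidean_iff euclidean_product_topology)
qed

text \<open>Solutions will be functions on all of \<open>nat\<close>, an infinite-dimensional space
  without Heine-Borel; a product of compact intervals is compact there all the same.\<close>

lemma compact_unit_cube: "compact {x :: 'a \<Rightarrow> 'b \<Rightarrow> real. \<forall>i j. x i j \<in> {0..1}}"
proof -
  have "compact (PiE (UNIV :: 'a set) (\<lambda>_. PiE (UNIV :: 'b set) (\<lambda>_. {0..1::real})))"
    by (intro compact_PiE_UNIV compact_Icc)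
  moreover have "PiE (UNIV :: 'a set) (\<lambda>_. PiE (UNIV :: 'b set) (\<lambda>_. {0..1::real})) =
      {x. \<forall>i j. x i j \<in> {0..1}}"
    by (auto simp: PiE_def Pi_def)
  ultimately show ?thesis by simp
qed

lemma continuous_on_entry:
  "continuous_on UNIV (\<lambda>z :: real \<times> ('a \<Rightarrow> 'b \<Rightarrow> real). snd z i j)"
proof -
  have "continuous_on UNIV (\<lambda>x :: 'a \<Rightarrow> 'b \<Rightarrow> real. x i j)"
    using continuous_on_compose2[OF continuous_on_product_coordinates[of j]
        continuous_on_product_coordinates[of i]] by auto
  then show ?thesis
    by (rule continuous_on_compose2[OF _ continuous_on_snd[OF continuous_on_id]]) simp
qed

lemma closed_lpr_feasible: "closed {z. lpr_feasible I (fst z) (snd z)}"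
proof -
  have ball: "closed {z. \<forall>i\<in>N. P i z}" if "\<And>i. closed {z. P i z}"
    for N :: "nat set" and P :: "nat \<Rightarrow> real \<times> (nat \<Rightarrow> nat \<Rightarrow> real) \<Rightarrow> bool"
  proof -
    have "{z. \<forall>i\<in>N. P i z} = (\<Inter>i\<in>N. {z. P i z})" by auto
    then show ?thesis using that by auto
  qed
  show ?thesis
    unfolding lpr_feasible_def
    by (intro closed_Collect_conj ball closed_Collect_le closed_Collect_eq continuous_on_sum
        continuous_on_mult continuous_on_entry continuous_on_const continuous_on_fst continuous_on_id)
qed

section \<open>Schedules as integral points of the relaxation, and bounds by OPT\<close>

lemma schedule_exists:
  assumes "smcc_instance I"
  shows "\<exists>A. is_schedule I A"
proof -
  obtain A where A: "A \<subseteq> machines I \<times> jobs I" "\<forall>j\<in>jobs I. \<exists>!i. (i, j) \<in> A"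
    "\<forall>i\<in>machines I. card {j. (i, j) \<in> A} \<le> capacity I i"
    using capacitated_assignment_exists[of "machines I" "jobs I" "capacity I"] assms
    by (auto simp: smcc_instance_def jobs_def)
  have "{j \<in> jobs I. (i, j) \<in> A} = {j. (i, j) \<in> A}" for i
    using A(1) by auto
  then have "is_schedule I A" unfolding is_schedule_def using A by simp
  then show ?thesis by blast
qed

lemma sum_unique_indicator:
  assumes "finite P" "\<exists>!i. Q i" "\<And>i. Q i \<Longrightarrow> i \<in> P"
  shows "(\<Sum>i\<in>P. (if Q i then 1 else 0 :: real)) = 1"
proof -
  obtain i where i: "Q i" using assms(2) by blast
  then have "Q k \<longleftrightarrow> k = i" for k using assms(2) by blast
  then show ?thesis using assms(1) assms(3)[OF i] by simp
qed

lemma makespan_load_le: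
  assumes "i \<in> machines I"
  shows "(\<Sum>j\<in>{j\<in>jobs I. (i, j) \<in> A}. job_length I j) \<le> makespan I A"
  unfolding makespan_def using assms by (intro Max_ge) auto

lemma schedule_lpr_feasible:
  assumes "is_schedule I A"
  shows "lpr_feasible I (makespan I A) (\<lambda>i j. if (i, j) \<in> A then 1 else 0)"
proof -
  have load: "(\<Sum>j\<in>jobs I. (if (i, j) \<in> A then 1 else 0) * real (job_length I j)) =
      (\<Sum>j\<in>{j\<in>jobs I. (i, j) \<in> A}. job_length I j)" for i
    by (subst of_nat_sum, subst sum.inter_filter) (auto intro: sum.cong)
  have count: "(\<Sum>j\<in>jobs I. (if (i, j) \<in> A then 1 else 0)) = real (card {j\<in>jobs I. (i, j) \<in> A})" for i
    by (simp add: sum.If_cases Int_def)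
  have assign: "(\<Sum>i\<in>machines I. (if (i, j) \<in> A then 1 else 0 :: real)) = 1" if "j \<in> jobs I" for j
  proof (rule sum_unique_indicator)
    show "\<exists>!i. (i, j) \<in> A" using assms that by (simp add: is_schedule_def)
    show "(i, j) \<in> A \<Longrightarrow> i \<in> machines I" for i using assms by (auto simp: is_schedule_def)
  qed simp
  have "card {j\<in>jobs I. (i, j) \<in> A} \<le> capacity I i" if "i \<in> machines I" for i
    using assms that by (simp add: is_schedule_def)
  then show ?thesis
    unfolding lpr_feasible_def load count of_nat_le_iff
    by (intro conjI ballI makespan_load_le assign) auto
qed

lemma finite_schedules: "finite {A. is_schedule I A}"
  by (rule finite_subset[of _ "Pow (machines I \<times> jobs I)"]) (auto simp: is_schedule_def)

lemma OPT_schedule: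
  assumes "smcc_instance I"
  obtains A where "is_schedule I A" "makespan I A = OPT I"
proof -
  have "OPT I \<in> makespan I ` {A. is_schedule I A}"
    unfolding OPT_def using finite_schedules schedule_exists[OF assms]
    by (intro Min_in) auto
  then show ?thesis using that by auto
qed

lemma lpr_feasible_entry_le_1:
  assumes "lpr_feasible I c x" "i \<in> machines I" "j \<in> jobs I"
  shows "x i j \<le> 1"
proof -
  have "x i j \<le> (\<Sum>i\<in>machines I. x i j)"
    using assms by (intro member_le_sum) (auto simp: lpr_feasible_def)
  then show ?thesis using assms by (auto simp: lpr_feasible_def)
qed

text \<open>Weierstrass on pairs (bound, solution): the objective is the first projection and
  feasibility is a closed condition. Bounds above the makespan of one fixed schedule cannot win, so
  \<open>c\<close> may be kept in a compact interval.\<close>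

lemma lpr_optimal_exists:
  assumes "smcc_instance I"
  shows "\<exists>x. lpr_optimal I x"
proof -
  obtain A where A: "is_schedule I A" using schedule_exists[OF assms] by blast
  define c0 where "c0 = real (makespan I A)"
  define K where "K = ({0..c0} \<times> {x. \<forall>i j. x i j \<in> {0..1}}) \<inter> {z. lpr_feasible I (fst z) (snd z)}"
  \<comment> \<open>Entries outside machines and jobs are unconstrained; setting them to 0 moves a
    feasible solution into the cube.\<close>
  define trunc where "trunc x = (\<lambda>i j. if i \<in> machines I \<and> j \<in> jobs I then x i j else 0 :: real)"
    for x :: "nat \<Rightarrow> nat \<Rightarrow> real"
  have inK: "(c, trunc x) \<in> K" if "lpr_feasible I c x" "c \<le> c0" for c x
  proof -
    have f: "lpr_feasible I c (trunc x)"
      using that unfolding lpr_feasible_def trunc_def by (auto cong: sum.cong)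
    have "1 \<in> machines I" using assms by (auto simp: smcc_instance_def machines_def)
    then have "(\<Sum>j\<in>jobs I. x 1 j * real (job_length I j)) \<le> c"
      using that(1) by (auto simp: lpr_feasible_def)
    moreover have "0 \<le> (\<Sum>j\<in>jobs I. x 1 j * real (job_length I j))"
      using that(1) \<open>1 \<in> machines I\<close> by (intro sum_nonneg) (auto simp: lpr_feasible_def)
    ultimately have "0 \<le> c" by simp
    then show ?thesis
      using f that lpr_feasible_entry_le_1[OF that(1)]
      by (auto simp: K_def trunc_def lpr_feasible_def)
  qed
  have "compact K"
    unfolding K_def by (intro compact_Int_closed compact_Times compact_unit_cube closed_lpr_feasible) simp
  moreover have "K \<noteq> {}"
    using inK[OF schedule_lpr_feasible[OF A]] by (auto simp: c0_def)
  ultimately obtain z where z: "z \<in> K" "\<forall>w\<in>K. fst z \<le> fst w"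
    using continuous_attains_inf[of K fst] continuous_on_fst[OF continuous_on_id, of K] by blast
  have "fst z \<le> c'" if "lpr_feasible I c' x'" for c' x'
  proof (cases "c' \<le> c0")
    case True
    then show ?thesis using z(2) inK[OF that] by force
  next
    case False
    then show ?thesis using z(1) by (auto simp: K_def)
  qed
  then show ?thesis using z(1) unfolding lpr_optimal_def K_def by blast
qed

text \<open>The 0/1 vector of an optimal schedule is feasible for LPR with bound
  \<open>OPT I\<close>, so the LPR optimum cannot exceed it.\<close>

lemma lpr_optimal_load_le_OPT:
  assumes "smcc_instance I" "lpr_optimal I x" "i \<in> machines I"
  shows "(\<Sum>j\<in>jobs I. x i j * real (job_length I j)) \<le> real (OPT I)"
proof -
  obtain A where "is_schedule I A" "makespan I A = OPT I" using OPT_schedule assms(1) by blast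
  then have "lpr_feasible I (OPT I) (\<lambda>i j. if (i, j) \<in> A then 1 else 0)"
    using schedule_lpr_feasible by metis
  moreover obtain c where "lpr_feasible I c x" "\<forall>c' x'. lpr_feasible I c' x' \<longrightarrow> c \<le> c'"
    using assms(2) by (auto simp: lpr_optimal_def)
  ultimately have "c \<le> OPT I" "(\<Sum>j\<in>jobs I. x i j * real (job_length I j)) \<le> c"
    using assms(3) unfolding lpr_feasible_def[of I c x] by blast+
  then show ?thesis by simp
qed

lemma job_length_le_OPT:
  assumes "smcc_instance I" "j \<in> jobs I"
  shows "job_length I j \<le> OPT I"
proof -
  obtain A where A: "is_schedule I A" "makespan I A = OPT I" using OPT_schedule assms(1) by blast
  then obtain i where i: "(i, j) \<in> A" "i \<in> machines I"
    using assms(2) unfolding is_schedule_def by (meson SigmaD1 subsetD)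
  have "job_length I j \<le> (\<Sum>j\<in>{j\<in>jobs I. (i, j) \<in> A}. job_length I j)"
    using i assms(2) by (intro member_le_sum) auto
  also have "\<dots> \<le> OPT I" using makespan_load_le[OF i(2)] A(2) by metis
  finally show ?thesis .
qed

section \<open>Existence of basic solutions\<close>

text \<open>The left-hand side of a constraint as a linear functional, separated from
  \<open>b\<close> so that it can also be evaluated at directions.\<close>

definition row :: "smcc \<Rightarrow> blpr_constraint \<Rightarrow> (nat \<Rightarrow> nat \<Rightarrow> real) \<Rightarrow> real" where
  "row I C z = (\<Sum>i\<in>machines I. \<Sum>j\<in>jobs I. coeff I C i j * z i j)"

lemma holds_with_equality_iff_row: "holds_with_equality I b z C \<longleftrightarrow> row I C z = rhs I b C"
  by (simp add: holds_with_equality_def row_def)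

lemma row_add_scaled: "row I C (\<lambda>i j. x i j + s * d i j) = row I C x + s * row I C d"
  by (simp add: row_def algebra_simps sum.distrib sum_distrib_left)

lemma row_Load: "p \<in> machines I \<Longrightarrow> row I (Load p) z = (\<Sum>j\<in>jobs I. z p j * real (job_length I j))"
proof -
  assume p: "p \<in> machines I"
  have "row I (Load p) z =
      (\<Sum>i\<in>machines I. if i = p then \<Sum>j\<in>jobs I. z p j * real (job_length I j) else 0)"
    unfolding row_def by (rule sum.cong) (auto simp: mult.commute)
  then show ?thesis using p by simp
qed

lemma row_Cap: "p \<in> machines I \<Longrightarrow> row I (Cap p) z = (\<Sum>j\<in>jobs I. z p j)"
proof -
  assume p: "p \<in> machines I"
  have "row I (Cap p) z = (\<Sum>i\<in>machines I. if i = p then \<Sum>j\<in>jobs I. z p j else 0)"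
    unfolding row_def by (rule sum.cong) auto
  then show ?thesis using p by simp
qed

lemma row_Assign: "q \<in> jobs I \<Longrightarrow> row I (Assign q) z = (\<Sum>i\<in>machines I. z i q)"
proof -
  assume q: "q \<in> jobs I"
  have "(\<Sum>j\<in>jobs I. coeff I (Assign q) i j * z i j) = (\<Sum>j\<in>jobs I. if j = q then z i q else 0)" for i
    by (rule sum.cong) auto
  then show ?thesis using q by (simp add: row_def)
qed

lemma row_entry:
  assumes "p \<in> machines I" "q \<in> jobs I"
  shows "row I (Nonneg p q) z = z p q" "row I (Fixed p q) z = z p q"
proof -
  have "(\<Sum>j\<in>jobs I. (if i = p \<and> j = q then 1 else 0) * z i j) =
      (\<Sum>j\<in>jobs I. if j = q then (if i = p then z p q else 0) else 0)" for i
    by (rule sum.cong) auto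
  then show "row I (Nonneg p q) z = z p q" "row I (Fixed p q) z = z p q"
    using assms by (simp_all add: row_def)
qed

fun is_equation :: "blpr_constraint \<Rightarrow> bool" where
  "is_equation (Assign _) = True"
| "is_equation (Fixed _ _) = True"
| "is_equation _ = False"

text \<open>Only \<open>Nonneg\<close> is a lower bound; the sign brings every constraint into the
  form \<le>, ready for a uniform ratio test.\<close>

fun orientation :: "blpr_constraint \<Rightarrow> real" where
  "orientation (Nonneg _ _) = -1"
| "orientation _ = 1"

lemma blpr_feasible_iff_rows:
  assumes "F \<subseteq> machines I \<times> jobs I"
  shows "blpr_feasible I b F x \<longleftrightarrow>
    (\<forall>C\<in>blpr_constraints I F.
       orientation C * row I C x \<le> orientation C * rhs I b C \<and>
       (is_equation C \<longrightarrow> row I C x = rhs I b C))" (is "?L \<longleftrightarrow> ?R")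
proof
  assume L: ?L
  show ?R
  proof
    fix C assume "C \<in> blpr_constraints I F"
    then show "orientation C * row I C x \<le> orientation C * rhs I b C \<and>
       (is_equation C \<longrightarrow> row I C x = rhs I b C)"
      using L assms unfolding blpr_constraints_def blpr_feasible_def
      by (auto simp: row_Load row_Cap row_Assign) (auto simp: row_entry dest!: subsetD)
  qed
next
  assume R: ?R
  have "row I (Load i) x \<le> b i" "row I (Cap i) x \<le> capacity I i" if "i \<in> machines I" for i
    using R[rule_format, of "Load i"] R[rule_format, of "Cap i"] that
    by (auto simp: blpr_constraints_def)
  moreover have "row I (Assign j) x = 1" if "j \<in> jobs I" for j
    using R[rule_format, of "Assign j"] that by (auto simp: blpr_constraints_def)
  moreover have "x i j = 1" if "(i, j) \<in> F" for i j
    using R[rule_format, of "Fixed i j"] that row_entry(2)[of i I j x] assms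
    by (auto simp: blpr_constraints_def)
  moreover have "x i j \<ge> 0" if "i \<in> machines I" "j \<in> jobs I" for i j
    using R[rule_format, of "Nonneg i j"] that row_entry(1)[of i I j x]
    by (auto simp: blpr_constraints_def)
  ultimately show ?L
    unfolding blpr_feasible_def by (auto simp: row_Load row_Cap row_Assign)
qed

lemma finite_blpr_constraints:
  assumes "F \<subseteq> machines I \<times> jobs I"
  shows "finite (blpr_constraints I F)"
proof -
  have "finite F" using assms finite_subset by fastforce
  moreover have "{Fixed i j | i j. (i, j) \<in> F} = case_prod Fixed ` F" by auto
  moreover have "{Nonneg i j | i j. i \<in> machines I \<and> j \<in> jobs I} =
      case_prod Nonneg ` (machines I \<times> jobs I)" by auto
  ultimately show ?thesis by (simp add: blpr_constraints_def)
qed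

definition tight_constraints ::
  "smcc \<Rightarrow> (nat \<Rightarrow> real) \<Rightarrow> (nat \<times> nat) set \<Rightarrow> (nat \<Rightarrow> nat \<Rightarrow> real) \<Rightarrow> blpr_constraint set" where
  "tight_constraints I b F x = {C \<in> blpr_constraints I F. row I C x = rhs I b C}"

text \<open>Moving along a direction that no tight constraint sees until the first blocking constraint.\<close>

lemma more_tight_constraints:
  assumes F: "F \<subseteq> machines I \<times> jobs I" and x: "blpr_feasible I b F x"
    and d: "\<forall>C\<in>tight_constraints I b F x. row I C d = 0"
    and neg: "p \<in> machines I" "q \<in> jobs I" "d p q < 0"
  shows "\<exists>x'. blpr_feasible I b F x' \<and> tight_constraints I b F x \<subset> tight_constraints I b F x'"
proof -
  define K where "K = blpr_constraints I F"
  define slack where "slack C = orientation C * (rhs I b C - row I C x)" for C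
  define rate where "rate C = orientation C * row I C d" for C
  define B where "B = {C \<in> K. rate C > 0}"
  have feas: "0 \<le> slack C" "is_equation C \<Longrightarrow> row I C x = rhs I b C" if "C \<in> K" for C
    using x that unfolding blpr_feasible_iff_rows[OF F] K_def slack_def
    by (auto simp: algebra_simps)
  have orient: "orientation C \<noteq> 0" for C by (cases C) auto
  have tight: "row I C d = 0" if "C \<in> K" "row I C x = rhs I b C" for C
    using d that by (auto simp: K_def tight_constraints_def)
  have B_tight: "row I C x \<noteq> rhs I b C" if "C \<in> B" for C
    using tight that by (force simp: B_def rate_def)
  have finB: "finite B" using finite_blpr_constraints[OF F] by (simp add: B_def K_def)
  \<comment> \<open>The negative entry of \<open>d\<close> enters here: \<open>Nonneg p q\<close>
    has the positive rate \<open>- d p q\<close>, so some constraint limits the step.\<close>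
  have "Nonneg p q \<in> B"
    using neg by (auto simp: B_def K_def rate_def row_entry blpr_constraints_def)
  then have "Min ((\<lambda>C. slack C / rate C) ` B) \<in> (\<lambda>C. slack C / rate C) ` B"
    using finB by (intro Min_in) auto
  then obtain C0 where C0: "C0 \<in> B" and C0_Min: "Min ((\<lambda>C. slack C / rate C) ` B) = slack C0 / rate C0"
    by auto
  have C0_min: "slack C0 / rate C0 \<le> slack C / rate C" if "C \<in> B" for C
    unfolding C0_Min[symmetric] using that finB by (intro Min_le) auto
  \<comment> \<open>Ratio test: the largest step that respects every constraint in \<open>B\<close>;
    \<open>C0\<close> becomes tight at it.\<close>
  define s where "s = slack C0 / rate C0"
  define x' where "x' = (\<lambda>i j. x i j + s * d i j)"
  have row': "row I C x' = row I C x + s * row I C d" for C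
    unfolding x'_def by (rule row_add_scaled)
  have "s \<ge> 0" using C0 feas by (auto simp: s_def B_def)
  have stay: "row I C x' = rhs I b C" if "C \<in> K" "row I C x = rhs I b C" for C
    using tight[OF that] that by (simp add: row')
  have "s * rate C \<le> slack C" if "C \<in> K" for C
  proof (cases "C \<in> B")
    case True
    then have "s \<le> slack C / rate C" "rate C > 0" using C0_min by (auto simp: s_def B_def)
    then show ?thesis by (simp add: pos_le_divide_eq)
  next
    case False
    then have "rate C \<le> 0" using that by (auto simp: B_def)
    then have "s * rate C \<le> 0" using \<open>s \<ge> 0\<close> by (simp add: mult_nonneg_nonpos)
    then show ?thesis using feas(1)[OF that] by simp
  qed
  then have "blpr_feasible I b F x'"
    unfolding blpr_feasible_iff_rows[OF F] K_def[symmetric]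
    using stay feas(2) by (auto simp: row' slack_def rate_def algebra_simps)
  moreover have "row I C0 x' = rhs I b C0"
  proof -
    have "s * rate C0 = slack C0" using C0 by (auto simp: s_def B_def)
    then have "orientation C0 * (row I C0 x + s * row I C0 d) = orientation C0 * rhs I b C0"
      by (simp add: slack_def rate_def algebra_simps)
    then show ?thesis using orient by (simp add: row')
  qed
  ultimately show ?thesis
    using stay C0 B_tight[OF C0]
    by (intro exI[of _ x']) (auto simp: tight_constraints_def K_def B_def)
qed

text \<open>A feasible point with the most tight constraints works: a nonzero difference of two
  solutions of the tight equations has, up to sign, a negative entry, and moving along it would gain
  a further tight constraint. Nonnegativity is what keeps the polyhedron from containing a
  line.\<close>

lemma feasible_determined_by_tight_constraints:
  assumes F: "F \<subseteq> machines I \<times> jobs I" and "blpr_feasible I b F x0"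
  shows "\<exists>x. blpr_feasible I b F x \<and>
    (\<forall>z. (\<forall>C\<in>tight_constraints I b F x. row I C z = rhs I b C) \<longrightarrow>
         (\<forall>i\<in>machines I. \<forall>j\<in>jobs I. z i j = x i j))"
proof -
  let ?T = "tight_constraints I b F"
  have fin: "finite (?T x)" for x
    using finite_blpr_constraints[OF F] by (simp add: tight_constraints_def)
  have "card (?T x) < Suc (card (blpr_constraints I F))" for x
    using finite_blpr_constraints[OF F]
    by (auto simp: tight_constraints_def less_Suc_eq_le intro!: card_mono)
  then obtain x where x: "blpr_feasible I b F x"
    and max: "\<And>y. blpr_feasible I b F y \<Longrightarrow> card (?T y) \<le> card (?T x)"
    using ex_has_greatest_nat[of "blpr_feasible I b F" x0 "\<lambda>x. card (?T x)"
        "Suc (card (blpr_constraints I F))"] assms(2) by blast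
  have noneg: "\<not> d p q < 0" if "\<forall>C\<in>?T x. row I C d = 0" "p \<in> machines I" "q \<in> jobs I" for d p q
    using more_tight_constraints[OF F x that] max psubset_card_mono[OF fin] by (metis leD)
  have "z i j = x i j"
    if z: "\<forall>C\<in>?T x. row I C z = rhs I b C" and ij: "i \<in> machines I" "j \<in> jobs I" for z i j
  proof -
    have row: "row I C (\<lambda>i j. s * (z i j - x i j)) = s * (row I C z - row I C x)" for s C
      by (simp add: row_def algebra_simps sum_subtractf sum_distrib_left)
    have "\<forall>C\<in>?T x. row I C (\<lambda>i j. s * (z i j - x i j)) = 0" for s
      unfolding row using z by (auto simp: tight_constraints_def)
    from noneg[OF this ij, of 1] noneg[OF this ij, of "-1"] show ?thesis by simp
  qed
  then show ?thesis using x by blast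
qed

text \<open>A largest independent subset spans, since any further constraint is a combination of it.
  Spanning is stated through the values of the functionals because uniqueness of solutions is
  transferred in that form.\<close>

lemma independent_spanning_subset:
  assumes "finite T"
  shows "\<exists>S\<subseteq>T. lin_independent I S \<and>
    (\<forall>z w. (\<forall>C\<in>S. row I C z = row I C w) \<longrightarrow> (\<forall>C\<in>T. row I C z = row I C w))"
proof -
  have "lin_independent I {}" by (simp add: lin_independent_def)
  moreover have "card S < Suc (card T)" if "S \<subseteq> T" for S
    using that assms by (simp add: card_mono less_Suc_eq_le)
  ultimately obtain S where S: "S \<subseteq> T" "lin_independent I S"
    and max: "\<And>S'. S' \<subseteq> T \<Longrightarrow> lin_independent I S' \<Longrightarrow> card S' \<le> card S"
    using ex_has_greatest_nat[of "\<lambda>S. S \<subseteq> T \<and> lin_independent I S" "{}" card "Suc (card T)"]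
    by (metis empty_subsetI)
  have finS: "finite S" using S(1) assms finite_subset by blast
  have "row I C z = row I C w" if eq: "\<forall>C\<in>S. row I C z = row I C w" and C: "C \<in> T" for z w C
  proof (cases "C \<in> S")
    case True
    then show ?thesis using eq by blast
  next
    case False
    then have "\<not> lin_independent I (insert C S)"
      using max[of "insert C S"] S(1) C finS by auto
    then obtain a where a: "\<forall>i\<in>machines I. \<forall>j\<in>jobs I. (\<Sum>D\<in>insert C S. a D * coeff I D i j) = 0"
      and ne: "\<exists>D\<in>insert C S. a D \<noteq> 0"
      unfolding lin_independent_def by blast
    have a': "a C * coeff I C i j + (\<Sum>D\<in>S. a D * coeff I D i j) = 0"
      if "i \<in> machines I" "j \<in> jobs I" for i j
      using a that False finS by simp
    have "a C \<noteq> 0"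
    proof
      assume "a C = 0"
      then have "\<forall>D\<in>S. a D = 0" using S(2) a' unfolding lin_independent_def by simp
      then show False using ne \<open>a C = 0\<close> by blast
    qed
    have comb: "a C * row I C v + (\<Sum>D\<in>S. a D * row I D v) = 0" for v
    proof -
      have "a C * row I C v + (\<Sum>D\<in>S. a D * row I D v) = (\<Sum>D\<in>insert C S. a D * row I D v)"
        using False finS by simp
      also have "\<dots> = (\<Sum>D\<in>insert C S. \<Sum>i\<in>machines I. \<Sum>j\<in>jobs I. a D * coeff I D i j * v i j)"
        by (simp add: row_def sum_distrib_left mult.assoc)
      also have "\<dots> = (\<Sum>i\<in>machines I. \<Sum>D\<in>insert C S. \<Sum>j\<in>jobs I. a D * coeff I D i j * v i j)"
        by (rule sum.swap)
      also have "\<dots> = (\<Sum>i\<in>machines I. \<Sum>j\<in>jobs I. \<Sum>D\<in>insert C S. a D * coeff I D i j * v i j)"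
        by (intro sum.cong refl sum.swap)
      also have "\<dots> = (\<Sum>i\<in>machines I. \<Sum>j\<in>jobs I. (\<Sum>D\<in>insert C S. a D * coeff I D i j) * v i j)"
        by (simp add: sum_distrib_right)
      also have "\<dots> = 0" using a by (simp cong: sum.cong)
      finally show ?thesis .
    qed
    have "(\<Sum>D\<in>S. a D * row I D z) = (\<Sum>D\<in>S. a D * row I D w)"
      using eq by (intro sum.cong) auto
    then have "a C * row I C z = a C * row I C w" using comb[of z] comb[of w] by linarith
    then show ?thesis using \<open>a C \<noteq> 0\<close> by simp
  qed
  then show ?thesis using S by blast
qed

text \<open>The tight constraints pin down \<open>x\<close> but may be dependent. An independent
  spanning subset suffices: any solution of it agrees with \<open>x\<close> on all tight
  rows.\<close>

lemma basic_solution_exists: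
  assumes F: "F \<subseteq> machines I \<times> jobs I" and "blpr_feasible I b F x0"
  shows "\<exists>x. basic_solution I b F x"
proof -
  let ?T = "tight_constraints I b F"
  obtain x where x: "blpr_feasible I b F x"
    and unique: "\<And>z. (\<forall>C\<in>?T x. row I C z = rhs I b C) \<Longrightarrow>
         (\<forall>i\<in>machines I. \<forall>j\<in>jobs I. z i j = x i j)"
    using feasible_determined_by_tight_constraints[OF assms] by blast
  have "finite (?T x)"
    using finite_blpr_constraints[OF F] by (simp add: tight_constraints_def)
  then obtain S where S: "S \<subseteq> ?T x" "lin_independent I S"
    and span: "\<And>z w. (\<forall>C\<in>S. row I C z = row I C w) \<Longrightarrow> (\<forall>C\<in>?T x. row I C z = row I C w)"
    using independent_spanning_subset[of "?T x" I] by meson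
  have tight: "row I C x = rhs I b C" if "C \<in> ?T x" for C
    using that by (simp add: tight_constraints_def)
  have "\<forall>i\<in>machines I. \<forall>j\<in>jobs I. z i j = x i j" if "\<forall>C\<in>S. row I C z = rhs I b C" for z
  proof (rule unique)
    have "\<forall>C\<in>S. row I C z = row I C x" using that S(1) tight by auto
    then show "\<forall>C\<in>?T x. row I C z = rhs I b C" using span[of z x] tight by simp
  qed
  moreover have "S \<subseteq> blpr_constraints I F"
    using S(1) by (auto simp: tight_constraints_def)
  ultimately show ?thesis
    unfolding basic_solution_def holds_with_equality_iff_row
    using x S(2) tight subsetD[OF S(1)] by (intro conjI exI[of _ x] exI[of _ S]) simp_all
qed

section \<open>Feasible solutions and the fixed assignments\<close>

lemma free_jobs_subset: "free_jobs I F \<subseteq> jobs I" and free_machines_subset: "free_machines I F \<subseteq> machines I"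
  by (auto simp: free_jobs_def free_machines_def)

lemma finite_free_jobs [simp]: "finite (free_jobs I F)"
  and finite_free_machines [simp]: "finite (free_machines I F)"
  by (auto simp: free_jobs_def free_machines_def)

lemma blpr_fixed_other_zero:
  assumes "blpr_feasible I b F x" "F \<subseteq> machines I \<times> jobs I" "(i, j) \<in> F" "i' \<in> machines I" "i' \<noteq> i"
  shows "x i' j = 0"
proof -
  have j: "j \<in> jobs I" "i \<in> machines I" using assms by auto
  have "(\<Sum>k\<in>{i, i'}. x k j) \<le> (\<Sum>k\<in>machines I. x k j)"
    using assms j by (intro sum_mono2) (auto simp: blpr_feasible_def)
  also have "\<dots> = 1" using assms j by (auto simp: blpr_feasible_def)
  finally have "x i j + x i' j \<le> 1" using assms(5) by simp
  moreover have "x i j = 1" using assms by (auto simp: blpr_feasible_def)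
  moreover have "x i' j \<ge> 0" using assms j by (auto simp: blpr_feasible_def)
  ultimately show ?thesis by linarith
qed

lemma blpr_fixed_unique:
  assumes "blpr_feasible I b F x" "F \<subseteq> machines I \<times> jobs I" "(i, j) \<in> F" "(i', j) \<in> F"
  shows "i' = i"
proof (rule ccontr)
  assume "i' \<noteq> i"
  moreover have "i' \<in> machines I" using assms by auto
  ultimately have "x i' j = 0" using blpr_fixed_other_zero assms by blast
  moreover have "x i' j = 1" using assms(1,4) by (auto simp: blpr_feasible_def)
  ultimately show False by simp
qed

text \<open>On jobs that are not free, row \<open>i\<close> of \<open>x\<close> is the indicator of
  \<open>F\<close>: 1 by the fixing equation, 0 elsewhere because columns sum to 1. The weight
  \<open>w\<close> covers counts (\<open>w\<close> = 1) and loads (\<open>w\<close> =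
  length).\<close>

lemma blpr_row_split:
  assumes "blpr_feasible I b F x" "F \<subseteq> machines I \<times> jobs I" "i \<in> machines I"
  shows "(\<Sum>j\<in>jobs I. x i j * w j) =
    (\<Sum>j\<in>{j\<in>jobs I. (i, j) \<in> F}. w j) + (\<Sum>j\<in>free_jobs I F. x i j * w j)"
proof -
  have eq: "x i j * w j = (if (i, j) \<in> F then w j else 0) +
      (if j \<in> free_jobs I F then x i j * w j else 0)" if j: "j \<in> jobs I" for j
  proof (cases "j \<in> free_jobs I F")
    case True
    then have "(i, j) \<notin> F" using assms(3) by (auto simp: free_jobs_def)
    then show ?thesis using True by simp
  next
    case False
    then obtain k where k: "(k, j) \<in> F" using j by (auto simp: free_jobs_def)
    show ?thesis
    proof (cases "k = i")
      case True
      then have "x i j = 1" using k assms(1) by (auto simp: blpr_feasible_def)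
      then show ?thesis using False True k by simp
    next
      case ne: False
      then have "x i j = 0" using blpr_fixed_other_zero[OF assms(1,2) k assms(3)] by simp
      moreover have "(i, j) \<notin> F" using blpr_fixed_unique[OF assms(1,2) k] ne by blast
      ultimately show ?thesis using False by simp
    qed
  qed
  have "(\<Sum>j\<in>jobs I. x i j * w j) = (\<Sum>j\<in>jobs I. if (i, j) \<in> F then w j else 0) +
      (\<Sum>j\<in>jobs I. if j \<in> free_jobs I F then x i j * w j else 0)"
    unfolding sum.distrib[symmetric] using eq by (rule sum.cong[OF refl])
  moreover have "{j \<in> jobs I. j \<in> free_jobs I F} = free_jobs I F"
    using free_jobs_subset by blast
  ultimately show ?thesis by (simp add: sum.inter_filter[symmetric])
qed

lemma blpr_free_nonneg:
  assumes "blpr_feasible I b F x" "i \<in> machines I" "j \<in> free_jobs I F"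
  shows "0 \<le> x i j"
  using assms free_jobs_subset[of I F] by (auto simp: blpr_feasible_def)

lemma blpr_assigned_count:
  assumes "blpr_feasible I b F x" "F \<subseteq> machines I \<times> jobs I" "i \<in> machines I"
  shows "real (assigned_count I F i) + (\<Sum>j\<in>free_jobs I F. x i j) \<le> real (capacity I i)"
proof -
  have "(\<Sum>j\<in>jobs I. x i j) = real (assigned_count I F i) + (\<Sum>j\<in>free_jobs I F. x i j)"
    using blpr_row_split[OF assms, of "\<lambda>_. 1"] by (simp add: assigned_count_def)
  then show ?thesis using assms by (auto simp: blpr_feasible_def)
qed

text \<open>The free part of the load is nonnegative. At the end this converts \<open>b\<close> into
  a bound on the integral schedule.\<close>

lemma blpr_fixed_load:
  assumes "blpr_feasible I b F x" "F \<subseteq> machines I \<times> jobs I" "i \<in> machines I"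
  shows "(\<Sum>j\<in>{j\<in>jobs I. (i, j) \<in> F}. real (job_length I j)) \<le> b i"
proof -
  have "0 \<le> (\<Sum>j\<in>free_jobs I F. x i j * real (job_length I j))"
    using blpr_free_nonneg[OF assms(1,3)] by (intro sum_nonneg) simp
  moreover have "(\<Sum>j\<in>jobs I. x i j * real (job_length I j)) \<le> b i"
    using assms by (auto simp: blpr_feasible_def)
  ultimately show ?thesis using blpr_row_split[OF assms, of "\<lambda>j. real (job_length I j)"] by linarith
qed

lemma blpr_count_le_capacity:
  assumes "blpr_feasible I b F x" "F \<subseteq> machines I \<times> jobs I" "i \<in> machines I"
  shows "assigned_count I F i \<le> capacity I i"
proof -
  have "0 \<le> (\<Sum>j\<in>free_jobs I F. x i j)"
    using blpr_free_nonneg[OF assms(1,3)] by (rule sum_nonneg)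
  then show ?thesis using blpr_assigned_count[OF assms] by linarith
qed

text \<open>The fixed jobs exhaust the capacity, leaving free mass 0. Hence free jobs are supported
  on free machines, and only the rows of these enter the count for basic solutions.\<close>

lemma blpr_full_machine_zero:
  assumes "blpr_feasible I b F x" "F \<subseteq> machines I \<times> jobs I" "i \<in> machines I"
    and "i \<notin> free_machines I F" "j \<in> free_jobs I F"
  shows "x i j = 0"
proof -
  have "assigned_count I F i \<ge> capacity I i" using assms(3,4) by (auto simp: free_machines_def)
  then have "(\<Sum>j\<in>free_jobs I F. x i j) \<le> 0" using blpr_assigned_count[OF assms(1-3)] by linarith
  moreover have "x i j \<le> (\<Sum>j\<in>free_jobs I F. x i j)"
    using blpr_free_nonneg[OF assms(1,3)] assms(5) by (intro member_le_sum) auto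
  ultimately show ?thesis using blpr_free_nonneg[OF assms(1,3,5)] by linarith
qed

section \<open>Basic solutions have an integral free pair\<close>

text \<open>A single positive entry would carry the whole sum and so equal 1.\<close>

lemma two_positive_entries:
  fixes f :: "'a \<Rightarrow> real"
  assumes "finite A" "(\<Sum>a\<in>A. f a) = 1" "\<And>a. a \<in> A \<Longrightarrow> 0 \<le> f a" "\<And>a. a \<in> A \<Longrightarrow> f a \<noteq> 1"
  shows "2 \<le> card {a\<in>A. 0 < f a}"
proof (rule ccontr)
  let ?P = "{a\<in>A. 0 < f a}"
  assume "\<not> 2 \<le> card ?P"
  moreover have sumP: "(\<Sum>a\<in>?P. f a) = 1"
    using assms(1,2,3) by (subst assms(2)[symmetric], intro sum.mono_neutral_left) force+
  moreover have "card ?P \<noteq> 0"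
  proof
    assume "card ?P = 0"
    then have "?P = {}" using assms(1) by simp
    then show False using sumP by (metis sum.empty zero_neq_one)
  qed
  ultimately have "card ?P = 1" by linarith
  then obtain a where a: "?P = {a}" by (auto simp: card_1_singleton_iff)
  then have "f a = 1" using sumP by simp
  then show False using a assms(4) by blast
qed

text \<open>
  If every free job were split, the support would have at least 2M* entries. The 2k* + M* rows of
  free machines and free jobs have rank at most 2k* + M* - 1, because the capacity rows and the
  assignment rows have the same sum; so some perturbation inside the support keeps every
  constraint that holds with equality.
\<close>

lemma basic_solution_integral_pair:
  assumes F: "F \<subseteq> machines I \<times> jobs I" and basic: "basic_solution I b F x"
    and pos: "card (free_jobs I F) > 0"
    and many: "card (free_jobs I F) \<ge> 2 * card (free_machines I F)"
  shows "\<exists>p\<in>free_machines I F. \<exists>q\<in>free_jobs I F. x p q = 1"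
proof (rule ccontr)
  assume neg: "\<not> (\<exists>p\<in>free_machines I F. \<exists>q\<in>free_jobs I F. x p q = 1)"
  let ?M = "free_machines I F" and ?J = "free_jobs I F"
  obtain S where feas: "blpr_feasible I b F x" and S: "S \<subseteq> blpr_constraints I F"
    and tight: "\<And>C. C \<in> S \<Longrightarrow> row I C x = rhs I b C"
    and unique: "\<And>z. (\<forall>C\<in>S. row I C z = rhs I b C) \<Longrightarrow>
      (\<forall>i\<in>machines I. \<forall>j\<in>jobs I. z i j = x i j)"
    using basic unfolding basic_solution_def holds_with_equality_iff_row by blast
  define E where "E = (\<Union>j\<in>?J. {i\<in>?M. 0 < x i j} \<times> {j})"
  have E_sub: "E \<subseteq> machines I \<times> jobs I"
    using free_jobs_subset[of I F] free_machines_subset[of I F] by (auto simp: E_def)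
  have finE: "finite E" by (auto simp: E_def)
  have "2 \<le> card {i\<in>?M. 0 < x i j}" if j: "j \<in> ?J" for j
  proof (rule two_positive_entries)
    have "(\<Sum>i\<in>?M. x i j) = (\<Sum>i\<in>machines I. x i j)"
      using blpr_full_machine_zero[OF feas F] j free_machines_subset[of I F]
      by (intro sum.mono_neutral_left) auto
    then show "(\<Sum>i\<in>?M. x i j) = 1"
      using feas j free_jobs_subset[of I F] by (auto simp: blpr_feasible_def)
    show "0 \<le> x i j" "x i j \<noteq> 1" if "i \<in> ?M" for i
      using that blpr_free_nonneg[OF feas _ j] free_machines_subset[of I F] neg j by auto
  qed simp
  then have "(\<Sum>j\<in>?J. 2) \<le> (\<Sum>j\<in>?J. card {i\<in>?M. 0 < x i j})" by (intro sum_mono) auto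
  also have "\<dots> = card E"
    unfolding E_def by (subst card_UN_disjoint) (auto simp: card_cartesian_product)
  finally have cardE: "2 * card ?J \<le> card E" by simp
  obtain j0 where j0: "j0 \<in> ?J" using pos by fastforce
  define R where "R = Load ` ?M \<union> Cap ` ?M \<union> Assign ` (?J - {j0})"
  have "card R \<le> card ?M + card ?M + card (?J - {j0})"
    unfolding R_def by (intro card_Un_le[THEN order_trans] add_mono card_image_le) auto
  \<comment> \<open>In the boundary case M* = 2k* it is the row dropped for \<open>j0\<close> that
    makes \<open>card R < card E\<close> strict.\<close>
  moreover have "card (?J - {j0}) < card ?J" using j0 by (intro psubset_card_mono) auto
  ultimately have "card R < card E" using cardE many by linarith
  then obtain d where d: "\<exists>e\<in>E. d e \<noteq> 0"
    "\<forall>r\<in>R. (\<Sum>e\<in>E. coeff I r (fst e) (snd e) * d e) = 0"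
    using underdetermined_system_nontrivial_solution[of R E "\<lambda>r e. coeff I r (fst e) (snd e)"] finE
    by (auto simp: R_def)
  define D where "D i j = (if (i, j) \<in> E then d (i, j) else 0)" for i j
  have D_zero: "D i j = 0" if "i \<notin> ?M \<or> j \<notin> ?J \<or> x i j = 0" for i j
    using that by (auto simp: D_def E_def)
  have row_D: "row I C D = (\<Sum>e\<in>E. coeff I C (fst e) (snd e) * d e)" for C
  proof -
    have "row I C D = (\<Sum>e\<in>machines I \<times> jobs I. coeff I C (fst e) (snd e) * D (fst e) (snd e))"
      by (simp add: row_def sum.cartesian_product case_prod_beta)
    also have "\<dots> = (\<Sum>e\<in>E. coeff I C (fst e) (snd e) * D (fst e) (snd e))"
      using E_sub by (intro sum.mono_neutral_right) (auto simp: D_def)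
    also have "\<dots> = (\<Sum>e\<in>E. coeff I C (fst e) (snd e) * d e)"
      by (intro sum.cong) (auto simp: D_def)
    finally show ?thesis .
  qed
  have row_R: "row I C D = 0" if "C \<in> R" for C using d(2) that row_D by auto
  have load: "row I (Load i) D = 0" and cap: "row I (Cap i) D = 0" if "i \<in> machines I" for i
  proof -
    show "row I (Load i) D = 0"
      using row_R[of "Load i"] that D_zero[of i] by (cases "i \<in> ?M") (auto simp: R_def row_Load)
    show "row I (Cap i) D = 0"
      using row_R[of "Cap i"] that D_zero[of i] by (cases "i \<in> ?M") (auto simp: R_def row_Cap)
  qed
  have assign_others: "row I (Assign j) D = 0" if "j \<in> jobs I" "j \<noteq> j0" for j
    using row_R[of "Assign j"] that D_zero[of _ j]
    by (cases "j \<in> ?J") (auto simp: R_def row_Assign)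
  have j0_job: "j0 \<in> jobs I" using j0 free_jobs_subset by blast
  \<comment> \<open>Double counting restores the dropped row: the entries of \<open>D\<close> sum to
    0 by the capacity rows, and every other assignment row vanishes.\<close>
  have "(\<Sum>j\<in>jobs I. row I (Assign j) D) = (\<Sum>j\<in>jobs I. \<Sum>i\<in>machines I. D i j)"
    by (intro sum.cong) (auto simp: row_Assign)
  also have "\<dots> = (\<Sum>i\<in>machines I. \<Sum>j\<in>jobs I. D i j)" by (rule sum.swap)
  also have "\<dots> = (\<Sum>i\<in>machines I. row I (Cap i) D)"
    by (intro sum.cong) (auto simp: row_Cap)
  also have "\<dots> = 0" using cap by simp
  finally have "row I (Assign j0) D = 0"
    using assign_others j0_job by (simp add: sum.remove[of "jobs I" j0])
  then have assign: "row I (Assign j) D = 0" if "j \<in> jobs I" for j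
    using assign_others that by blast
  have "row I C D = 0" if C: "C \<in> S" for C
  proof (cases C)
    case (Fixed i j)
    then have "(i, j) \<in> F" using C S by (auto simp: blpr_constraints_def)
    then have "i \<in> machines I" "j \<in> jobs I" "j \<notin> ?J" using F by (auto simp: free_jobs_def)
    then show ?thesis using Fixed D_zero[of i j] by (simp add: row_entry)
  next
    \<comment> \<open>Tightness says \<open>x i j = 0\<close> here, so the pair lies outside the
      support and \<open>D\<close> vanishes on it.\<close>
    case (Nonneg i j)
    then have "i \<in> machines I" "j \<in> jobs I" using C S by (auto simp: blpr_constraints_def)
    then show ?thesis using tight[OF C] D_zero[of i j] Nonneg by (simp add: row_entry)
  qed (use C S load cap assign in \<open>auto simp: blpr_constraints_def\<close>)
  \<comment> \<open>Uniqueness ranges over all solutions of the equations in \<open>S\<close>,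
    feasible or not, so the step length 1 is allowed.\<close>
  then have "row I C (\<lambda>i j. x i j + 1 * D i j) = rhs I b C" if "C \<in> S" for C
    unfolding row_add_scaled using that tight by simp
  then have "\<forall>i\<in>machines I. \<forall>j\<in>jobs I. x i j + 1 * D i j = x i j"
    using unique[of "\<lambda>i j. x i j + 1 * D i j"] by blast
  then have "D i j = 0" if "i \<in> machines I" "j \<in> jobs I" for i j using that by simp
  then show False using d(1) E_sub by (force simp: D_def)
qed

section \<open>Invariant of the iteration\<close>

text \<open>
  The fractional jobs on p are handed to the other machines in exchange for their shares of q.
  As q is a longest free job and p has free mass at most 1, no other machine gets more load or
  more jobs. For x p q = 1 the division by zero is harmless: all exchanged amounts vanish.
\<close>

lemma blpr_feasible_longest:
  assumes x: "blpr_feasible I b F x" and F: "F \<subseteq> machines I \<times> jobs I"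
    and p: "p \<in> free_machines I F" "free_capacity I F p = 1"
    and q: "q \<in> free_jobs I F" "\<forall>j\<in>free_jobs I F. job_length I j \<le> job_length I q"
  shows "\<exists>x'. blpr_feasible I (b(p := b p + real (job_length I q))) (F \<union> {(p, q)}) x'"
proof -
  let ?J = "free_jobs I F - {q}"
  define s where "s = 1 - x p q"
  \<comment> \<open>\<open>q\<close> moves wholly to \<open>p\<close>; every other free job leaves
    \<open>p\<close> and is spread over the other machines in proportion to their shares of
    \<open>q\<close>, which sum to \<open>s\<close>.\<close>
  define x' where "x' i j =
    (if j = q then (if i = p then 1 else 0)
     else if j \<in> free_jobs I F then (if i = p then 0 else x i j + x p j * (x i q / s))
     else x i j)" for i j
  have pM: "p \<in> machines I" and qJ: "q \<in> jobs I"
    using p q free_machines_subset[of I F] free_jobs_subset[of I F] by auto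
  have nn: "0 \<le> x i j" if "i \<in> machines I" "j \<in> jobs I" for i j
    using x that by (auto simp: blpr_feasible_def)
  have nnJ: "0 \<le> x p j" if "j \<in> ?J" for j using that nn pM free_jobs_subset[of I F] by auto
  have col: "(\<Sum>i\<in>machines I. x i j) = 1" if "j \<in> jobs I" for j
    using x that by (auto simp: blpr_feasible_def)
  have cap_p: "real (assigned_count I F p) + 1 = real (capacity I p)"
    using p by (auto simp: free_capacity_def)
  \<comment> \<open>Free capacity 1 bounds the free mass on \<open>p\<close> by 1; removing the
    share of \<open>q\<close> leaves at most \<open>s\<close>.\<close>
  have mass: "(\<Sum>j\<in>?J. x p j) \<le> s"
    using blpr_assigned_count[OF x F pM] cap_p q(1)
    by (simp add: s_def sum.remove[of "free_jobs I F" q])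
  have s0: "0 \<le> s" using mass sum_nonneg[of ?J "x p"] nnJ by force
  have other: "(\<Sum>i\<in>machines I - {p}. x i q) = s"
    using col[OF qJ] pM by (simp add: s_def sum.remove)
  \<comment> \<open>A general weight that is largest at \<open>q\<close> lets one estimate serve for
    loads (lengths) and for counts (\<open>w\<close> = 1).\<close>
  have row_other: "(\<Sum>j\<in>jobs I. x' i j * w j) \<le> (\<Sum>j\<in>jobs I. x i j * w j)"
    if i: "i \<in> machines I" "i \<noteq> p" and w: "\<And>j. j \<in> ?J \<Longrightarrow> w j \<le> w q" "0 \<le> w q"
    for i and w :: "nat \<Rightarrow> real"
  proof -
    have "x' i j * w j = x i j * w j - (if j = q then x i q * w q else 0) +
        (if j \<in> ?J then x p j * w j * (x i q / s) else 0)" for j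
      using i by (auto simp: x'_def algebra_simps)
    then have "(\<Sum>j\<in>jobs I. x' i j * w j) = (\<Sum>j\<in>jobs I. x i j * w j)
        - (\<Sum>j\<in>jobs I. if j = q then x i q * w q else 0)
        + (\<Sum>j\<in>jobs I. if j \<in> ?J then x p j * w j * (x i q / s) else 0)"
      by (simp only: sum.distrib sum_subtractf)
    also have "(\<Sum>j\<in>jobs I. if j = q then x i q * w q else 0) = x i q * w q"
      using qJ by simp
    also have "(\<Sum>j\<in>jobs I. if j \<in> ?J then x p j * w j * (x i q / s) else 0) =
        (\<Sum>j\<in>?J. x p j * w j * (x i q / s))"
    proof -
      have "{j \<in> jobs I. j \<in> ?J} = ?J" using free_jobs_subset[of I F] by blast
      then show ?thesis by (simp only: sum.inter_filter[symmetric] finite_jobs)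
    qed
    also have "\<dots> = (\<Sum>j\<in>?J. x p j * w j) * (x i q / s)"
      by (simp only: sum_distrib_right)
    finally have eq: "(\<Sum>j\<in>jobs I. x' i j * w j) = (\<Sum>j\<in>jobs I. x i j * w j)
        - x i q * w q + (\<Sum>j\<in>?J. x p j * w j) * (x i q / s)" .
    have "(\<Sum>j\<in>?J. x p j * w j) \<le> (\<Sum>j\<in>?J. x p j * w q)"
      using nnJ w(1) by (intro sum_mono mult_left_mono)
    also have "\<dots> = (\<Sum>j\<in>?J. x p j) * w q" by (simp only: sum_distrib_right)
    also have "\<dots> \<le> s * w q" using mass w(2) by (rule mult_right_mono)
    finally have le: "(\<Sum>j\<in>?J. x p j * w j) \<le> s * w q" .
    have nniq: "0 \<le> x i q" using nn i qJ by simp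
    \<comment> \<open>Machine \<open>i\<close> receives the fraction \<open>x i q / s\<close> of a
      total weight of at most \<open>s * w q\<close>, hence at most the \<open>x i q * w q\<close>
      that it gives up.\<close>
    have "(\<Sum>j\<in>?J. x p j * w j) * (x i q / s) \<le> s * w q * (x i q / s)"
      using le nniq s0 by (intro mult_right_mono) auto
    also have "\<dots> \<le> x i q * w q" using nniq w(2) by (cases "s = 0") auto
    finally show ?thesis using eq by linarith
  qed
  \<comment> \<open>After the exchange \<open>p\<close> carries only \<open>q\<close> and its fixed
    jobs, so raising its bound by the length of \<open>q\<close> is enough.\<close>
  have row_p: "(\<Sum>j\<in>jobs I. x' p j * w j) = w q + (\<Sum>j\<in>{j\<in>jobs I. (p, j) \<in> F}. w j)"
    for w :: "nat \<Rightarrow> real"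
  proof -
    have "x' p j * w j = x p j * w j + (if j = q then w q else 0)
        - (if j \<in> free_jobs I F then x p j * w j else 0)" for j
      using q(1) by (auto simp: x'_def)
    then have "(\<Sum>j\<in>jobs I. x' p j * w j) = (\<Sum>j\<in>jobs I. x p j * w j)
        + (\<Sum>j\<in>jobs I. if j = q then w q else 0)
        - (\<Sum>j\<in>jobs I. if j \<in> free_jobs I F then x p j * w j else 0)"
      by (simp only: sum.distrib sum_subtractf)
    also have "(\<Sum>j\<in>jobs I. if j \<in> free_jobs I F then x p j * w j else 0) =
        (\<Sum>j\<in>free_jobs I F. x p j * w j)"
    proof -
      have "{j \<in> jobs I. j \<in> free_jobs I F} = free_jobs I F" using free_jobs_subset[of I F] by blast
      then show ?thesis by (simp only: sum.inter_filter[symmetric] finite_jobs)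
    qed
    also have "(\<Sum>j\<in>jobs I. if j = q then w q else 0) = w q" using qJ by simp
    finally show ?thesis using blpr_row_split[OF x F pM, of w] by linarith
  qed
  let ?b = "b(p := b p + real (job_length I q))"
  have "(\<Sum>j\<in>jobs I. x' i j * real (job_length I j)) \<le> ?b i" if i: "i \<in> machines I" for i
  proof (cases "i = p")
    case True
    then show ?thesis
      using row_p[of "\<lambda>j. real (job_length I j)"] blpr_fixed_load[OF x F pM] by simp
  next
    case False
    have "(\<Sum>j\<in>jobs I. x i j * real (job_length I j)) \<le> b i"
      using x i by (auto simp: blpr_feasible_def)
    then show ?thesis
      using row_other[OF i False, of "\<lambda>j. real (job_length I j)"] q(2) False by simp
  qed
  moreover have "(\<Sum>j\<in>jobs I. x' i j) \<le> real (capacity I i)" if i: "i \<in> machines I" for i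
  proof (cases "i = p")
    case True
    then show ?thesis
      using row_p[of "\<lambda>_. 1"] cap_p by (simp add: assigned_count_def)
  next
    case False
    have "(\<Sum>j\<in>jobs I. x i j) \<le> real (capacity I i)"
      using x i by (auto simp: blpr_feasible_def)
    then show ?thesis using row_other[OF i False, of "\<lambda>_. 1"] by simp
  qed
  moreover have "(\<Sum>i\<in>machines I. x' i j) = 1" if j: "j \<in> jobs I" for j
  proof (cases "j \<in> ?J")
    case True
    have "(\<Sum>i\<in>machines I. x' i j) = x' p j + (\<Sum>i\<in>machines I - {p}. x' i j)"
      using pM by (simp add: sum.remove)
    also have "\<dots> = (\<Sum>i\<in>machines I - {p}. x i j + x p j * (x i q / s))"
      using True by (simp add: x'_def)
    also have "\<dots> = (\<Sum>i\<in>machines I - {p}. x i j) + x p j * ((\<Sum>i\<in>machines I - {p}. x i q) / s)"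
      by (simp add: sum.distrib sum_distrib_left sum_divide_distrib)
    also have "\<dots> = (1 - x p j) + x p j * (s / s)"
      using col[OF j] pM other by (simp add: sum.remove)
    also have "\<dots> = 1"
    proof (cases "s = 0")
      case s: True
      have "x p j \<le> (\<Sum>j\<in>?J. x p j)" using True nnJ by (intro member_le_sum) auto
      then have "x p j = 0" using mass s nnJ[OF True] by linarith
      then show ?thesis by simp
    qed simp
    finally show ?thesis .
  next
    case False
    then show ?thesis using col[OF j] pM by (cases "j = q") (auto simp: x'_def)
  qed
  moreover have "x' i j = 1" if "(i, j) \<in> F \<union> {(p, q)}" for i j
  proof (cases "(i, j) = (p, q)")
    case False
    then have ij: "(i, j) \<in> F" using that by blast
    then have "j \<notin> free_jobs I F" using F by (auto simp: free_jobs_def)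
    moreover have "x i j = 1" using x ij by (auto simp: blpr_feasible_def)
    ultimately show ?thesis using q(1) by (auto simp: x'_def)
  qed (simp add: x'_def)
  moreover have "0 \<le> x' i j" if "i \<in> machines I" "j \<in> jobs I" for i j
    using nn[OF that] nn[OF pM that(2)] nn[OF that(1) qJ] s0 by (simp add: x'_def)
  ultimately show ?thesis
    unfolding blpr_feasible_def by (intro exI[of _ x']) auto
qed

text \<open>All jobs become fixed, so the new solution is integral; the old \<open>x\<close>
  certifies that the jobs fixed so far respect \<open>b\<close>, the capacities and uniqueness. A
  free machine whose free capacity is not 1 has room for two jobs.\<close>

lemma blpr_feasible_rest:
  assumes x: "blpr_feasible I b F x" and F: "F \<subseteq> machines I \<times> jobs I"
    and cap: "\<forall>p\<in>free_machines I F. free_capacity I F p \<noteq> 1"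
    and A: "A \<subseteq> free_machines I F \<times> free_jobs I F" "\<forall>j\<in>free_jobs I F. \<exists>!i. (i, j) \<in> A"
      "\<forall>i\<in>free_machines I F. card {j. (i, j) \<in> A} \<le> 2"
  shows "blpr_feasible I (\<lambda>p. b p + (\<Sum>j\<in>{j. (p, j) \<in> A}. real (job_length I j))) (F \<union> A)
    (\<lambda>i j. if (i, j) \<in> F \<union> A then 1 else 0)"
proof -
  define x' :: "nat \<Rightarrow> nat \<Rightarrow> real" where "x' = (\<lambda>i j. if (i, j) \<in> F \<union> A then 1 else 0)"
  have finA: "finite {j. (i, j) \<in> A}" for i
    by (rule finite_subset[of _ "free_jobs I F"]) (use A(1) in auto)
  have row: "(\<Sum>j\<in>jobs I. x' i j * w j) =
      (\<Sum>j\<in>{j\<in>jobs I. (i, j) \<in> F}. w j) + (\<Sum>j\<in>{j. (i, j) \<in> A}. w j)"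
    for i and w :: "nat \<Rightarrow> real"
  proof -
    have "(\<Sum>j\<in>jobs I. x' i j * w j) = (\<Sum>j\<in>jobs I. if (i, j) \<in> F \<union> A then w j else 0)"
      by (rule sum.cong) (auto simp: x'_def)
    also have "\<dots> = (\<Sum>j\<in>{j\<in>jobs I. (i, j) \<in> F \<union> A}. w j)"
      by (simp only: sum.inter_filter finite_jobs)
    also have "{j\<in>jobs I. (i, j) \<in> F \<union> A} = {j\<in>jobs I. (i, j) \<in> F} \<union> {j. (i, j) \<in> A}"
      using A(1) free_jobs_subset[of I F] by auto
    also have "(\<Sum>j\<in>\<dots>. w j) = (\<Sum>j\<in>{j\<in>jobs I. (i, j) \<in> F}. w j) + (\<Sum>j\<in>{j. (i, j) \<in> A}. w j)"
      using A(1) F finA by (intro sum.union_disjoint) (auto simp: free_jobs_def)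
    finally show ?thesis .
  qed
  have "(\<Sum>j\<in>jobs I. x' i j * real (job_length I j))
      \<le> b i + (\<Sum>j\<in>{j. (i, j) \<in> A}. real (job_length I j))" if "i \<in> machines I" for i
    using row[of i "\<lambda>j. real (job_length I j)"] blpr_fixed_load[OF x F that] by simp
  moreover have "(\<Sum>j\<in>jobs I. x' i j) \<le> real (capacity I i)" if i: "i \<in> machines I" for i
  proof -
    have sum: "(\<Sum>j\<in>jobs I. x' i j) = real (assigned_count I F i + card {j. (i, j) \<in> A})"
      using row[of i "\<lambda>_. 1"] by (simp add: assigned_count_def)
    have "assigned_count I F i + card {j. (i, j) \<in> A} \<le> capacity I i"
    proof (cases "i \<in> free_machines I F")
      case True
      then have "card {j. (i, j) \<in> A} \<le> 2" "capacity I i - assigned_count I F i \<noteq> 1"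
        "assigned_count I F i < capacity I i"
        using A(3) cap by (auto simp: free_capacity_def free_machines_def)
      then show ?thesis by linarith
    next
      case False
      then have "{j. (i, j) \<in> A} = {}" using A(1) by auto
      then show ?thesis using blpr_count_le_capacity[OF x F i] by simp
    qed
    then show ?thesis unfolding sum by simp
  qed
  moreover have "(\<Sum>i\<in>machines I. x' i j) = 1" if j: "j \<in> jobs I" for j
    unfolding x'_def
  proof (rule sum_unique_indicator)
    show "\<exists>!i. (i, j) \<in> F \<union> A"
    proof (cases "j \<in> free_jobs I F")
      case True
      then have "(i, j) \<in> F \<union> A \<longleftrightarrow> (i, j) \<in> A" for i using F by (auto simp: free_jobs_def)
      then show ?thesis using A(2) True by simp
    next
      case False
      then obtain i where "(i, j) \<in> F" using j by (auto simp: free_jobs_def)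
      moreover have "k = i" if "(k, j) \<in> F \<union> A" for k
        using that False A(1) blpr_fixed_unique[OF x F \<open>(i, j) \<in> F\<close>] by blast
      ultimately show ?thesis by blast
    qed
    show "(i, j) \<in> F \<union> A \<Longrightarrow> i \<in> machines I" for i
      using F A(1) free_machines_subset[of I F] by auto
  qed simp
  ultimately show ?thesis
    unfolding blpr_feasible_def x'_def[symmetric] by (auto simp: x'_def)
qed

text \<open>The last clause is limited to states with a free job: after the final assignment a
  machine may still have free slots although its bound has been raised.\<close>

definition ira_invariant :: "smcc \<Rightarrow> (nat \<Rightarrow> real) \<Rightarrow> (nat \<times> nat) set \<Rightarrow> bool" where
  "ira_invariant I b F \<longleftrightarrow>
     F \<subseteq> machines I \<times> jobs I \<and> (\<exists>x. blpr_feasible I b F x) \<and>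
     (\<forall>i\<in>machines I. b i \<le> 3 * real (OPT I)) \<and>
     (free_jobs I F \<noteq> {} \<longrightarrow> (\<forall>i\<in>free_machines I F. b i \<le> real (OPT I)))"

text \<open>\<open>Solved\<close> keeps the guard under which \<open>x\<close> was computed, since
  the choice of the pair is a separate transition whose possibility rests on that guard.\<close>

fun ira_state_invariant :: "smcc \<Rightarrow> ira_state \<Rightarrow> bool" where
  "ira_state_invariant I Init \<longleftrightarrow> True"
| "ira_state_invariant I (Loop b F) \<longleftrightarrow> ira_invariant I b F"
| "ira_state_invariant I (Solved b F x) \<longleftrightarrow> ira_invariant I b F \<and> basic_solution I b F x \<and>
     card (free_jobs I F) > 0 \<and> card (free_jobs I F) \<ge> 2 * card (free_machines I F)"
| "ira_state_invariant I (Output F) \<longleftrightarrow> free_jobs I F = {} \<and> (\<exists>b. ira_invariant I b F)"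

section \<open>Preservation of the invariant by each transition\<close>

lemma free_machines_antimono:
  assumes "F \<subseteq> F'"
  shows "free_machines I F' \<subseteq> free_machines I F"
proof -
  have "assigned_count I F i \<le> assigned_count I F' i" for i
    unfolding assigned_count_def using assms by (intro card_mono) auto
  then show ?thesis using order.strict_trans1 by (fastforce simp: free_machines_def)
qed

lemma free_jobs_antimono: "F \<subseteq> F' \<Longrightarrow> free_jobs I F' \<subseteq> free_jobs I F"
  by (auto simp: free_jobs_def)

lemma ira_invariant_init:
  assumes "smcc_instance I" "lpr_optimal I x"
  shows "ira_invariant I (\<lambda>i. \<Sum>j\<in>jobs I. x i j * real (job_length I j)) {}"
proof -
  have le: "(\<Sum>j\<in>jobs I. x i j * real (job_length I j)) \<le> real (OPT I)" if "i \<in> machines I" for i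
    using lpr_optimal_load_le_OPT[OF assms that] .
  moreover have "(\<Sum>j\<in>jobs I. x i j * real (job_length I j)) \<le> 3 * real (OPT I)"
    if "i \<in> machines I" for i
    using le[OF that] by simp
  moreover have "blpr_feasible I (\<lambda>i. \<Sum>j\<in>jobs I. x i j * real (job_length I j)) {} x"
    using assms(2) by (auto simp: lpr_optimal_def lpr_feasible_def blpr_feasible_def)
  ultimately show ?thesis
    using free_machines_subset[of I "{}"] unfolding ira_invariant_def by blast
qed

text \<open>\<open>x\<close> already satisfies the new equation, so the same point stays feasible
  with \<open>b\<close> unchanged.\<close>

lemma ira_invariant_fix_pair:
  assumes inv: "ira_invariant I b F" and x: "basic_solution I b F x"
    and p: "p \<in> free_machines I F" "q \<in> free_jobs I F" "x p q = 1"
  shows "ira_invariant I b (F \<union> {(p, q)})"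
proof -
  have "blpr_feasible I b (F \<union> {(p, q)}) x"
    using x p(3) by (auto simp: basic_solution_def blpr_feasible_def)
  moreover have "p \<in> machines I" "q \<in> jobs I"
    using p free_machines_subset[of I F] free_jobs_subset[of I F] by auto
  ultimately show ?thesis
    using inv p(2) free_machines_antimono[of F "F \<union> {(p, q)}" I]
    unfolding ira_invariant_def by blast
qed

text \<open>The only free slot of \<open>p\<close> is used up, so \<open>p\<close> stops being free:
  its bound, now at most 2 OPT, only has to meet 3 OPT.\<close>

lemma ira_invariant_longest:
  assumes I: "smcc_instance I" and inv: "ira_invariant I b F"
    and p: "p \<in> free_machines I F" "free_capacity I F p = 1"
    and q: "q \<in> free_jobs I F" "\<forall>j\<in>free_jobs I F. job_length I j \<le> job_length I q"
  shows "ira_invariant I (b(p := b p + real (job_length I q))) (F \<union> {(p, q)})"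
proof -
  let ?b = "b(p := b p + real (job_length I q))" and ?F = "F \<union> {(p, q)}"
  have F: "F \<subseteq> machines I \<times> jobs I" using inv by (simp add: ira_invariant_def)
  have pq: "p \<in> machines I" "q \<in> jobs I"
    using p q free_machines_subset[of I F] free_jobs_subset[of I F] by auto
  have "\<exists>x. blpr_feasible I ?b ?F x"
    using inv blpr_feasible_longest[OF _ F p q] by (auto simp: ira_invariant_def)
  moreover have "p \<notin> free_machines I ?F"
  proof -
    have "{j \<in> jobs I. (p, j) \<in> ?F} = insert q {j \<in> jobs I. (p, j) \<in> F}" using pq by auto
    moreover have "(p, q) \<notin> F" using q(1) pq by (auto simp: free_jobs_def)
    ultimately have "assigned_count I ?F p = Suc (assigned_count I F p)"
      by (simp add: assigned_count_def)
    then show ?thesis using p(2) by (auto simp: free_machines_def free_capacity_def)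
  qed
  moreover have "b p \<le> real (OPT I)" "\<forall>i\<in>free_machines I F. b i \<le> real (OPT I)"
    using inv p q by (auto simp: ira_invariant_def)
  moreover have "real (job_length I q) \<le> real (OPT I)" using job_length_le_OPT[OF I pq(2)] by simp
  moreover have "\<forall>i\<in>machines I. b i \<le> 3 * real (OPT I)" using inv by (simp add: ira_invariant_def)
  moreover have "?F \<subseteq> machines I \<times> jobs I" using F pq by auto
  ultimately show ?thesis
    using free_machines_antimono[of F ?F I] unfolding ira_invariant_def by auto
qed

text \<open>A free machine starts from at most OPT and gains at most two job lengths. No free job
  remains, so the clause on free machines becomes vacuous.\<close>

lemma ira_invariant_rest:
  assumes I: "smcc_instance I" and inv: "ira_invariant I b F" and ne: "free_jobs I F \<noteq> {}"
    and cap: "\<forall>p\<in>free_machines I F. free_capacity I F p \<noteq> 1"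
    and A: "A \<subseteq> free_machines I F \<times> free_jobs I F" "\<forall>j\<in>free_jobs I F. \<exists>!i. (i, j) \<in> A"
      "\<forall>i\<in>free_machines I F. card {j. (i, j) \<in> A} \<le> 2"
  shows "ira_invariant I (\<lambda>p. b p + (\<Sum>j\<in>{j. (p, j) \<in> A}. real (job_length I j))) (F \<union> A)"
proof -
  have F: "F \<subseteq> machines I \<times> jobs I" using inv by (simp add: ira_invariant_def)
  obtain x where x: "blpr_feasible I b F x" using inv by (auto simp: ira_invariant_def)
  have "j \<notin> free_jobs I (F \<union> A)" for j
  proof
    assume j: "j \<in> free_jobs I (F \<union> A)"
    then have "j \<in> free_jobs I F" using free_jobs_antimono[of F "F \<union> A" I] by blast
    then obtain i where "(i, j) \<in> A" using A(2) by blast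
    then show False using j A(1) free_machines_subset[of I F] by (auto simp: free_jobs_def)
  qed
  then have empty: "free_jobs I (F \<union> A) = {}" by blast
  have bound: "b i + (\<Sum>j\<in>{j. (i, j) \<in> A}. real (job_length I j)) \<le> 3 * real (OPT I)"
    if i: "i \<in> machines I" for i
  proof (cases "i \<in> free_machines I F")
    case True
    have "(\<Sum>j\<in>{j. (i, j) \<in> A}. real (job_length I j)) \<le> real (card {j. (i, j) \<in> A}) * real (OPT I)"
      using A(1) free_jobs_subset[of I F] job_length_le_OPT[OF I] by (intro sum_bounded_above) auto
    also have "\<dots> \<le> 2 * real (OPT I)"
      using A(3) True by (intro mult_right_mono) auto
    finally show ?thesis using inv True ne by (force simp: ira_invariant_def)
  next
    case False
    then have "{j. (i, j) \<in> A} = {}" using A(1) by auto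
    then show ?thesis using inv i by (simp add: ira_invariant_def)
  qed
  have "F \<union> A \<subseteq> machines I \<times> jobs I"
    using F A(1) free_machines_subset[of I F] free_jobs_subset[of I F] by blast
  then show "ira_invariant I (\<lambda>p. b p + (\<Sum>j\<in>{j. (p, j) \<in> A}. real (job_length I j))) (F \<union> A)"
    unfolding ira_invariant_def
    using blpr_feasible_rest[OF x F cap A] bound empty by blast
qed

lemma ira_step_invariant:
  assumes "smcc_instance I" "ira_step I s s'" "ira_state_invariant I s"
  shows "ira_state_invariant I s'"
  using assms(2,3)
proof cases
  case init
  then show ?thesis using ira_invariant_init[OF assms(1)] by simp
next
  case (fix_pair p F q x b)
  then show ?thesis using ira_invariant_fix_pair[of I b F x p q] assms(3) by simp
next
  case longest
  then show ?thesis using ira_invariant_longest[OF assms(1)] assms(3) by simp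
next
  case (rest F A b)
  have "free_jobs I F \<noteq> {}" using rest(3) by auto
  then show ?thesis using ira_invariant_rest(1)[OF assms(1)] rest assms(3) by simp
qed auto

lemma ira_reachable_invariant:
  assumes "smcc_instance I" "ira_reachable I s"
  shows "ira_state_invariant I s"
  using assms(2) unfolding ira_reachable_def
  by (induction rule: rtranclp_induct) (auto intro: ira_step_invariant[OF assms(1)])

section \<open>Progress, termination and correctness of the output\<close>

lemma ira_progress:
  assumes I: "smcc_instance I" and inv: "ira_state_invariant I s"
  shows "(\<exists>F. s = Output F) \<or> (\<exists>s'. ira_step I s s')"
proof (cases s)
  case Init
  then show ?thesis using lpr_optimal_exists[OF I] ira_step.init by blast
next
  case (Solved b F x)
  then have "\<exists>p\<in>free_machines I F. \<exists>q\<in>free_jobs I F. x p q = 1"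
    using inv by (intro basic_solution_integral_pair) (auto simp: ira_invariant_def)
  then show ?thesis using Solved ira_step.fix_pair by blast
next
  case (Loop b F)
  let ?J = "free_jobs I F" and ?M = "free_machines I F"
  have F: "F \<subseteq> machines I \<times> jobs I" using inv Loop by (simp add: ira_invariant_def)
  consider "card ?J = 0" | "card ?J > 0" "card ?J \<ge> 2 * card ?M"
    | p where "card ?J > 0" "card ?J < 2 * card ?M" "p \<in> ?M" "free_capacity I F p = 1"
    | "card ?J > 0" "card ?J < 2 * card ?M" "\<forall>p\<in>?M. free_capacity I F p \<noteq> 1"
    by (metis gr0I not_le)
  then show ?thesis
  proof cases
    case 1
    then show ?thesis using Loop ira_step.finish by blast
  next
    case 2
    obtain x where "blpr_feasible I b F x" using inv Loop by (auto simp: ira_invariant_def)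
    then obtain x where "basic_solution I b F x" using basic_solution_exists[OF F] by blast
    then show ?thesis using Loop ira_step.solve[OF 2] by blast
  next
    case (3 p)
    then have "?J \<noteq> {}" by auto
    then have "Max (job_length I ` ?J) \<in> job_length I ` ?J" by (intro Max_in) auto
    then obtain q where q: "q \<in> ?J" "job_length I q = Max (job_length I ` ?J)" by auto
    then have "\<forall>j\<in>?J. job_length I j \<le> job_length I q" by simp
    then show ?thesis using Loop ira_step.longest[OF 3 q(1)] by blast
  next
    case 4
    have "card ?J \<le> (\<Sum>i\<in>?M. 2)" using 4(2) by simp
    then obtain A where "A \<subseteq> ?M \<times> ?J" "\<forall>j\<in>?J. \<exists>!i. (i, j) \<in> A" "\<forall>i\<in>?M. card {j. (i, j) \<in> A} \<le> 2"
      using capacitated_assignment_exists[of ?M ?J "\<lambda>_. 2"] by auto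
    then show ?thesis using Loop ira_step.rest[OF 4] by blast
  qed
qed simp

text \<open>Doubling leaves room for the intermediate state: \<open>solve\<close> fixes no job, yet
  descends from the odd value of \<open>Loop\<close> to the even value of
  \<open>Solved\<close>.\<close>

fun remaining_work :: "smcc \<Rightarrow> ira_state \<Rightarrow> nat" where
  "remaining_work I Init = 2 * card (free_jobs I {}) + 2"
| "remaining_work I (Loop b F) = 2 * card (free_jobs I F) + 1"
| "remaining_work I (Solved b F x) = 2 * card (free_jobs I F)"
| "remaining_work I (Output F) = 0"

lemma card_free_jobs_less:
  assumes "(p, q) \<in> F'" "F \<subseteq> F'" "p \<in> machines I" "q \<in> free_jobs I F"
  shows "card (free_jobs I F') < card (free_jobs I F)"
  using assms free_jobs_antimono[OF assms(2), of I]
  by (intro psubset_card_mono) (auto simp: free_jobs_def)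

lemma ira_step_decreases:
  assumes "ira_step I s s'"
  shows "remaining_work I s' < remaining_work I s"
  using assms
proof cases
  case (fix_pair p F q x b)
  then have "card (free_jobs I (F \<union> {(p, q)})) < card (free_jobs I F)"
    using free_machines_subset[of I F] by (intro card_free_jobs_less[of p q]) auto
  then show ?thesis using fix_pair by simp
next
  case (longest F p q b)
  then have "card (free_jobs I (F \<union> {(p, q)})) < card (free_jobs I F)"
    using free_machines_subset[of I F] by (intro card_free_jobs_less[of p q]) auto
  then show ?thesis using longest by simp
next
  case (rest F A b)
  then obtain q where q: "q \<in> free_jobs I F" by fastforce
  then obtain p where "(p, q) \<in> A" using rest(7) by blast
  then have "card (free_jobs I (F \<union> A)) < card (free_jobs I F)"
    using free_machines_subset[of I F] rest(6) q by (intro card_free_jobs_less[of p q]) auto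
  then show ?thesis using rest by simp
qed auto

lemma ira_terminates: "\<nexists>s :: nat \<Rightarrow> ira_state. \<forall>n. ira_step I (s n) (s (Suc n))"
proof
  assume "\<exists>s :: nat \<Rightarrow> ira_state. \<forall>n. ira_step I (s n) (s (Suc n))"
  then obtain s :: "nat \<Rightarrow> ira_state" where "\<forall>n. ira_step I (s n) (s (Suc n))" by blast
  then have "\<forall>n. (remaining_work I (s (Suc n)), remaining_work I (s n)) \<in> less_than"
    using ira_step_decreases by simp
  then have "\<exists>f. \<forall>n. (f (Suc n), f n) \<in> less_than"
    by (intro exI[of _ "\<lambda>n. remaining_work I (s n)"])
  then show False
    by (rule notE[OF wf_less_than[unfolded wf_iff_no_infinite_down_chain]])
qed

lemma ira_output_correct:
  assumes I: "smcc_instance I" and inv: "ira_state_invariant I (Output F)"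
  shows "is_schedule I F \<and> makespan I F \<le> 3 * OPT I"
proof -
  obtain b x where F: "F \<subseteq> machines I \<times> jobs I" and x: "blpr_feasible I b F x"
    and b: "\<forall>i\<in>machines I. b i \<le> 3 * real (OPT I)"
    using inv by (auto simp: ira_invariant_def)
  have "\<exists>!i. (i, j) \<in> F" if j: "j \<in> jobs I" for j
  proof -
    obtain i where i: "(i, j) \<in> F" using inv j by (auto simp: free_jobs_def)
    then show ?thesis using blpr_fixed_unique[OF x F i] by blast
  qed
  then have "is_schedule I F"
    using F blpr_count_le_capacity[OF x F] by (simp add: is_schedule_def assigned_count_def)
  moreover have "(\<Sum>j\<in>{j\<in>jobs I. (i, j) \<in> F}. job_length I j) \<le> 3 * OPT I"
    if i: "i \<in> machines I" for i
  proof -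
    have "real (\<Sum>j\<in>{j\<in>jobs I. (i, j) \<in> F}. job_length I j) \<le> real (3 * OPT I)"
      using blpr_fixed_load[OF x F i] b i by force
    then show ?thesis by (simp only: of_nat_le_iff)
  qed
  moreover have "machines I \<noteq> {}" using I by (auto simp: smcc_instance_def machines_def)
  ultimately show ?thesis by (auto simp: makespan_def)
qed

text \<open>Since IRA is nondeterministic, the claim about its output splits into termination of all
  runs, absence of stuck states and correctness of every output.\<close>

theorem theorem4:
  fixes I :: smcc
  assumes "smcc_instance I"
  shows "(\<nexists>s :: nat \<Rightarrow> ira_state. s 0 = Init \<and> (\<forall>n. ira_step I (s n) (s (Suc n)))) \<and>
         (\<forall>s. ira_reachable I s \<longrightarrow> (\<exists>F. s = Output F) \<or> (\<exists>s'. ira_step I s s')) \<and>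
         (\<forall>F. ira_reachable I (Output F) \<longrightarrow> is_schedule I F \<and> makespan I F \<le> 3 * OPT I)"
  using ira_terminates[of I] ira_progress[OF assms] ira_output_correct[OF assms]
    ira_reachable_invariant[OF assms] by blast

end
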